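(* Let $\mu,e,A^+,A^-,\varepsilon>0$ be constants and let $(u,\rho,c^+,c^-,\psi)$ be a smooth solution on the periodic domain $\Pi^d$ ($d=3$), with $\rho>0$ and $c^\pm>0$, of the system $$\partial_t\rho+\operatorname{div}(\rho u)=0,$$ $$\partial_t(\rho u)+\operatorname{div}(\rho u\otimes u)+\nabla p(\rho)-2\mu\operatorname{div}(\rho D(u))=\varepsilon\Delta\psi\nabla\psi-\nabla(c^++c^-),$$ $$\partial_t c^++\operatorname{div}(c^+u)=\operatorname{div}(A^+\nabla c^+)+\operatorname{div}(A^+e\,c^+\nabla\psi),$$ $$\partial_t c^-+\operatorname{div}(c^-u)=\operatorname{div}(A^-\nabla c^-)-\operatorname{div}(A^-e\,c^-\nabla\psi),$$ $$-\varepsilon\Delta\psi=e(c^+-c^-),$$ with initial conditions $\rho|_{t=0}=\rho_0$, $(\rho u)|_{t=0}=m_0$, $c^\pm|_{t=0}=c^\pm_0$. Then $$\frac{d}{dt}E_2(t)+8\mu\int_{\Pi^d}|\nabla\sqrt{c^+}|^2+8\mu\int_{\Pi^d}|\nabla\sqrt{c^-}|^2+2\mu\int_{\Pi^d}\varepsilon|\Delta\psi|^2+2\int_{\Pi^d}\mu\rho|A(u)|^2+2\mu\int_{\Pi^d}\frac{p'(\rho)}{\rho}|\nabla\rho|^2$$ $$+\int_{\Pi^d}A^+c^+|\nabla(\ln c^++e\psi)|^2+\int_{\Pi^d}A^-c^-|\nabla(\ln c^--e\psi)|^2=0,$$ where $$E_2(t)=\frac12\int_{\Pi^d}\rho|u+2\mu\nabla\ln\rho|^2+\int_{\Pi^d}\rho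 h(\rho)+\int_{\Pi^d}\varepsilon\frac{|\nabla\psi|^2}{2}+\int_{\Pi^d}\big(\sigma(c^+)+\sigma(c^-)\big)+2\mu\int_{\Pi^d}\Big(\frac1{A^+}\rho\,\sigma\big(\tfrac{c^+}{\rho}\big)+\frac1{A^-}\rho\,\sigma\big(\tfrac{c^-}{\rho}\big)\Big).$$
   Context: $\Pi^d$ ($d=3$) is the periodic box (torus). $D(u)=(\nabla u+{}^t\nabla u)/2$ and $A(u)=(\nabla u-{}^t\nabla u)/2$ (not to be confused with the constants $A^\pm$); $\sigma(s)=s\ln s-s+1$. For constants $c_1,c_2>0$, $k\ge1$, $\gamma>1$ the pressure is $p(\rho)=c_1(1-\rho^{-4k})$ for $0<\rho\le1$ and $p(\rho)=c_2(\rho^\gamma-1)$ for $\rho>1$, so $p'(\rho)=4kc_1\rho^{-4k-1}$ for $\rho<1$ and $p'(\rho)=\gamma c_2\rho^{\gamma-1}$ for $\rho>1$. The internal energy function $h$ (distinct from the constant $e$) is defined by $\rho^2h'(\rho)=p(\rho)$ with reference state $1$, i.e. $h(\rho)=\int_1^\rho p(s)s^{-2}\,ds$. *)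

theory Defs
  imports "HOL-Analysis.Analysis"
begin

(* Continuous Frechet differentiability up to the boundary: derivatives are taken within S.
   For the convex sets with nonempty interior used below they are unique. *)
primrec Ck_on :: "nat \<Rightarrow> 'a::euclidean_space set \<Rightarrow> ('a \<Rightarrow> 'b::real_normed_vector) \<Rightarrow> bool" where
  "Ck_on 0 S f \<longleftrightarrow> continuous_on S f"
| "Ck_on (Suc k) S f \<longleftrightarrow>
     (\<exists>f'. (\<forall>x\<in>S. (f has_derivative f' x) (at x within S)) \<and> (\<forall>v. Ck_on k S (\<lambda>x. f' x v)))"

definition smooth_on :: "'a::euclidean_space set \<Rightarrow> ('a \<Rightarrow> 'b::real_normed_vector) \<Rightarrow> bool" where
  "smooth_on S f \<longleftrightarrow> (\<forall>k. Ck_on k S f)"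

(* Functions on the torus are functions on the whole space that are L$i-periodic in the
   i-th coordinate; integrals over the torus are integrals over the cell cbox 0 L. *)
definition box_periodic :: "real^3 \<Rightarrow> (real^3 \<Rightarrow> 'b) \<Rightarrow> bool" where
  "box_periodic L f \<longleftrightarrow> (\<forall>x i. f (x + axis i (L $ i)) = f x)"

(* Smooth on [0,T) x torus, smoothness including the initial time. *)
definition smooth_periodic :: "real^3 \<Rightarrow> real \<Rightarrow> (real \<Rightarrow> real^3 \<Rightarrow> 'b::real_normed_vector) \<Rightarrow> bool" where
  "smooth_periodic L T f \<longleftrightarrow>
     smooth_on ({0..<T} \<times> UNIV) (\<lambda>(t, x). f t x) \<and> (\<forall>t\<in>{0..<T}. box_periodic L (f t))"

(* One-sided at t = 0, the usual partial derivative for 0 < t < T. *)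
definition ddt :: "real \<Rightarrow> (real \<Rightarrow> real^3 \<Rightarrow> 'b::real_normed_vector) \<Rightarrow> real \<Rightarrow> real^3 \<Rightarrow> 'b" where
  "ddt T f t x = vector_derivative (\<lambda>s. f s x) (at t within {0..<T})"

definition grad :: "(real^3 \<Rightarrow> real) \<Rightarrow> real^3 \<Rightarrow> real^3" where
  "grad f x = (\<chi> i. frechet_derivative f (at x) (axis i 1))"

definition divg :: "(real^3 \<Rightarrow> real^3) \<Rightarrow> real^3 \<Rightarrow> real" where
  "divg F x = trace (jacobian F (at x))"

definition mat_divg :: "(real^3 \<Rightarrow> real^3^3) \<Rightarrow> real^3 \<Rightarrow> real^3" where
  "mat_divg M x = (\<chi> i. divg (\<lambda>y. M y $ i) x)"

definition laplacian :: "(real^3 \<Rightarrow> real) \<Rightarrow> real^3 \<Rightarrow> real" where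
  "laplacian f x = divg (grad f) x"

definition outer :: "real^3 \<Rightarrow> real^3 \<Rightarrow> real^3^3" where
  "outer a b = (\<chi> i j. a $ i * b $ j)"

definition sym_grad :: "(real^3 \<Rightarrow> real^3) \<Rightarrow> real^3 \<Rightarrow> real^3^3" where
  "sym_grad u x = (1/2) *\<^sub>R (jacobian u (at x) + transpose (jacobian u (at x)))"

(* The norm of real^3^3 is the Frobenius norm. *)
definition skew_grad :: "(real^3 \<Rightarrow> real^3) \<Rightarrow> real^3 \<Rightarrow> real^3^3" where
  "skew_grad u x = (1/2) *\<^sub>R (jacobian u (at x) - transpose (jacobian u (at x)))"

definition sigma :: "real \<Rightarrow> real" where
  "sigma s = s * ln s - s + 1"

(* Only densities r > 0 are relevant.  The derivative has a jump at r = 1 unless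
   4 * k * c1 = \<gamma> * c2. *)
definition pressure :: "real \<Rightarrow> real \<Rightarrow> real \<Rightarrow> real \<Rightarrow> real \<Rightarrow> real" where
  "pressure c1 c2 k \<gamma> r =
     (if r \<le> 1 then c1 * (1 - r powr (- 4 * k)) else c2 * (r powr \<gamma> - 1))"

(* The interval integral is oriented, hence sign-reversed for r < 1. *)
definition internal_energy :: "real \<Rightarrow> real \<Rightarrow> real \<Rightarrow> real \<Rightarrow> real \<Rightarrow> real" where
  "internal_energy c1 c2 k \<gamma> r = (LBINT s=1..r. pressure c1 c2 k \<gamma> s / s\<^sup>2)"

definition energy2 ::
  "real^3 \<Rightarrow> (real \<Rightarrow> real) \<Rightarrow> real \<Rightarrow> real \<Rightarrow> real \<Rightarrow> real \<Rightarrow>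
   (real \<Rightarrow> real^3 \<Rightarrow> real^3) \<Rightarrow> (real \<Rightarrow> real^3 \<Rightarrow> real) \<Rightarrow> (real \<Rightarrow> real^3 \<Rightarrow> real) \<Rightarrow>
   (real \<Rightarrow> real^3 \<Rightarrow> real) \<Rightarrow> (real \<Rightarrow> real^3 \<Rightarrow> real) \<Rightarrow> real \<Rightarrow> real"
where
  "energy2 L h \<mu> \<epsilon> Ap Am u \<rho> cp cm \<psi> t =
     1/2 * integral (cbox 0 L)
       (\<lambda>x. \<rho> t x * (norm (u t x + (2 * \<mu>) *\<^sub>R grad (\<lambda>y. ln (\<rho> t y)) x))\<^sup>2)
   + integral (cbox 0 L) (\<lambda>x. \<rho> t x * h (\<rho> t x))
   + integral (cbox 0 L) (\<lambda>x. \<epsilon> * ((norm (grad (\<psi> t) x))\<^sup>2 / 2))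
   + integral (cbox 0 L) (\<lambda>x. sigma (cp t x) + sigma (cm t x))
   + 2 * \<mu> * integral (cbox 0 L)
       (\<lambda>x. 1 / Ap * \<rho> t x * sigma (cp t x / \<rho> t x) + 1 / Am * \<rho> t x * sigma (cm t x / \<rho> t x))"

end

theory Submission
  imports Defs
begin

text \<open>
  The identity combines three energy balances.

  The basic one tests the momentum equation with \<open>u\<close> and the ion equations with the electrochemical
  potentials \<open>\<phi>\<^sup>+ = ln c\<^sup>+ + e \<psi>\<close> and \<open>\<phi>\<^sup>- = ln c\<^sup>- - e \<psi>\<close>.  By the Poisson equation the
  force on the fluid is \<open>- (c\<^sup>+ \<nabla>\<phi>\<^sup>+ + c\<^sup>- \<nabla>\<phi>\<^sup>-)\<close>, so its work cancels against the convection of the ions, and the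
  two diffusion terms \<open>A c |\<nabla>\<phi>|\<^sup>2\<close> remain.

  The second idea, due to Bresch and Desjardins, is to test with \<open>w = u + 2 \<mu> \<nabla> ln \<rho>\<close> instead.  The gradient
  of the continuity equation says \<open>\<rho> (\<partial>\<^sub>t + u \<cdot> \<nabla>) \<nabla> ln \<rho> = - div (\<rho> (\<nabla>u)\<^sup>T)\<close>, and since the viscosity is
  proportional to the density, the sum of the two equations is an equation for \<open>w\<close> whose stress
  is \<open>2 \<mu> \<rho> A(u)\<close>, which is skew.  As \<open>w - u\<close> is a gradient, this stress dissipates
  \<open>2 \<mu> \<rho> |A(u)|\<^sup>2\<close>.  The pressure contributes \<open>2 \<mu> \<nabla> ln \<rho> \<cdot> \<nabla>p(\<rho>)\<close>, which is the term with \<open>p'(\<rho>)\<close>,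
  but now the ionic force also does work on \<open>2 \<mu> \<nabla> ln \<rho>\<close>, and this has no sign.

  The relative entropies \<open>\<rho> \<sigma>(c/\<rho>) / A\<close>, taken \<open>2 \<mu>\<close> times, absorb that work.  Their time derivative is,
  up to a divergence, \<open>- c \<nabla>\<phi> \<cdot> \<nabla>(ln c - ln \<rho>)\<close>.  The part with \<open>ln \<rho>\<close> cancels the work of the ionic force on \<open>\<nabla> ln \<rho>\<close>, the
  part with \<open>ln c\<close> gives \<open>c |\<nabla> ln c|\<^sup>2 = 4 |\<nabla>\<surd>c|\<^sup>2\<close> and the terms
  \<open>e \<nabla>\<psi> \<cdot> \<nabla>(c\<^sup>+ - c\<^sup>-)\<close>, which after an integration by parts and the Poisson equation become \<open>\<epsilon> |\<Delta>\<psi>|\<^sup>2\<close>.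

  Everything except the internal energy is smooth and is treated pointwise, modulo divergences of periodic
  fluxes: \<open>effective_velocity_balance\<close>, \<open>free_energy_balance\<close> and \<open>relative_entropies_balance\<close> add up to \<open>energy_balance\<close>.
  The pressure may have a corner at density \<open>1\<close>; the internal energy is then only continuously differentiable,
  and it is treated in \<open>internal_energy_balance\<close>.  At a point where \<open>\<rho> = 1\<close>, the assumed differentiability of \<open>p(\<rho>)\<close>
  makes \<open>\<nabla>\<rho>\<close> vanish or the two slopes of the pressure equal (\<open>pressure_chain_rule\<close>).
\<close>

section \<open>Arithmetic of smooth functions\<close>

lemma Ck_on_cong:
  assumes "Ck_on k S f" "\<And>x. x \<in> S \<Longrightarrow> f x = g x"
  shows "Ck_on k S g"
proof (cases k)
  case 0
  then show ?thesis using assms continuous_on_cong by auto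
next
  case (Suc m)
  then obtain f' where f': "\<forall>x\<in>S. (f has_derivative f' x) (at x within S)" "\<forall>v. Ck_on m S (\<lambda>x. f' x v)"
    using assms by auto
  then have "\<forall>x\<in>S. (g has_derivative f' x) (at x within S)"
    using assms(2) by (metis has_derivative_transform)
  with f' Suc show ?thesis by auto
qed

lemma Ck_on_Suc_imp: "Ck_on (Suc k) S f \<Longrightarrow> Ck_on k S f"
proof (induction k arbitrary: f)
  case 0
  then show ?case by (auto intro: has_derivative_continuous_on)
next
  case (Suc k)
  then obtain f' where "\<forall>x\<in>S. (f has_derivative f' x) (at x within S)" "\<forall>v. Ck_on (Suc k) S (\<lambda>x. f' x v)"
    by auto
  with Suc.IH show ?case by auto
qed

lemma Ck_on_const: "Ck_on k S (\<lambda>x. c)"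
  by (induction k arbitrary: c) (auto intro!: exI[of _ "\<lambda>x h. 0"])

lemma Ck_on_bounded_linear:
  assumes "bounded_linear l"
  shows "Ck_on k S f \<Longrightarrow> Ck_on k S (\<lambda>x. l (f x))"
proof (induction k arbitrary: f)
  case 0
  then show ?case using assms by (simp add: bounded_linear.continuous_on)
next
  case (Suc k)
  then obtain f' where f': "\<forall>x\<in>S. (f has_derivative f' x) (at x within S)" "\<forall>v. Ck_on k S (\<lambda>x. f' x v)"
    by auto
  have "\<forall>x\<in>S. ((\<lambda>x. l (f x)) has_derivative (\<lambda>h. l (f' x h))) (at x within S)"
    using f'(1) bounded_linear.has_derivative[OF assms] by blast
  with Suc.IH f'(2) show ?case by auto
qed

lemma Ck_on_add: "Ck_on k S f \<Longrightarrow> Ck_on k S g \<Longrightarrow> Ck_on k S (\<lambda>x. f x + g x)"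
proof (induction k arbitrary: f g)
  case 0
  then show ?case by (simp add: continuous_on_add)
next
  case (Suc k)
  obtain f' where f': "\<forall>x\<in>S. (f has_derivative f' x) (at x within S)" "\<forall>v. Ck_on k S (\<lambda>x. f' x v)"
    using Suc.prems by auto
  obtain g' where g': "\<forall>x\<in>S. (g has_derivative g' x) (at x within S)" "\<forall>v. Ck_on k S (\<lambda>x. g' x v)"
    using Suc.prems by auto
  have "\<forall>x\<in>S. ((\<lambda>x. f x + g x) has_derivative (\<lambda>h. f' x h + g' x h)) (at x within S)"
    using f' g' by (auto intro!: derivative_intros)
  with Suc.IH f'(2) g'(2) show ?case by auto
qed

text \<open>
  The derivative of a product contains the factors themselves, so the induction is over all pairs of functions
  and also needs the factors at the lower order.
\<close>

lemma Ck_on_mult: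
  fixes f g :: "'a::euclidean_space \<Rightarrow> real"
  shows "Ck_on k S f \<Longrightarrow> Ck_on k S g \<Longrightarrow> Ck_on k S (\<lambda>x. f x * g x)"
proof (induction k arbitrary: f g)
  case 0
  then show ?case by (simp add: continuous_on_mult)
next
  case (Suc k)
  obtain f' where f': "\<forall>x\<in>S. (f has_derivative f' x) (at x within S)" "\<forall>v. Ck_on k S (\<lambda>x. f' x v)"
    using Suc.prems by auto
  obtain g' where g': "\<forall>x\<in>S. (g has_derivative g' x) (at x within S)" "\<forall>v. Ck_on k S (\<lambda>x. g' x v)"
    using Suc.prems by auto
  have "Ck_on k S f" "Ck_on k S g" using Suc.prems Ck_on_Suc_imp by blast+
  then have "\<forall>v. Ck_on k S (\<lambda>x. f x * g' x v + f' x v * g x)"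
    using Suc.IH f'(2) g'(2) by (auto intro!: Ck_on_add)
  moreover have "\<forall>x\<in>S. ((\<lambda>x. f x * g x) has_derivative (\<lambda>h. f x * g' x h + f' x h * g x)) (at x within S)"
    using f' g' by (auto intro!: has_derivative_mult)
  ultimately show ?case
    by (auto intro!: exI[of _ "\<lambda>x h. f x * g' x h + f' x h * g x"])
qed

lemma Ck_on_inverse:
  fixes f :: "'a::euclidean_space \<Rightarrow> real"
  assumes nz: "\<And>x. x \<in> S \<Longrightarrow> f x \<noteq> 0"
  shows "Ck_on k S f \<Longrightarrow> Ck_on k S (\<lambda>x. inverse (f x))"
proof (induction k)
  case 0
  then show ?case using nz by (simp add: continuous_on_inverse)
next
  case (Suc k)
  obtain f' where f': "\<forall>x\<in>S. (f has_derivative f' x) (at x within S)" "\<forall>v. Ck_on k S (\<lambda>x. f' x v)"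
    using Suc.prems by auto
  have I: "Ck_on k S (\<lambda>x. inverse (f x))"
    using Suc.IH Suc.prems Ck_on_Suc_imp by blast
  have "\<forall>v. Ck_on k S (\<lambda>x. (- 1) * (inverse (f x) * f' x v * inverse (f x)))"
    using f'(2) I by (intro allI Ck_on_mult Ck_on_const) auto
  moreover have "\<forall>x\<in>S. ((\<lambda>x. inverse (f x)) has_derivative (\<lambda>h. (- 1) * (inverse (f x) * f' x h * inverse (f x)))) (at x within S)"
    using f' nz has_derivative_inverse by fastforce
  ultimately show ?case
    by (auto intro!: exI[of _ "\<lambda>x h. (- 1) * (inverse (f x) * f' x h * inverse (f x))"])
qed

lemma Ck_on_ln:
  fixes f :: "'a::euclidean_space \<Rightarrow> real"
  assumes pos: "\<And>x. x \<in> S \<Longrightarrow> f x > 0" and f: "Ck_on k S f"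
  shows "Ck_on k S (\<lambda>x. ln (f x))"
proof (cases k)
  case 0
  then show ?thesis using f pos by (auto intro!: continuous_on_ln simp: less_imp_neq[symmetric])
next
  case (Suc m)
  obtain f' where f': "\<forall>x\<in>S. (f has_derivative f' x) (at x within S)" "\<forall>v. Ck_on m S (\<lambda>x. f' x v)"
    using f Suc by auto
  have "Ck_on m S (\<lambda>x. inverse (f x))"
    using f Suc Ck_on_Suc_imp Ck_on_inverse pos by (metis less_irrefl)
  with f'(2) have "\<forall>v. Ck_on m S (\<lambda>x. f' x v * inverse (f x))"
    by (auto intro: Ck_on_mult)
  moreover have "\<forall>x\<in>S. ((\<lambda>x. ln (f x)) has_derivative (\<lambda>h. f' x h * inverse (f x))) (at x within S)"
    using f' pos by (auto intro!: has_derivative_ln)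
  ultimately show ?thesis unfolding Suc
    by (auto intro!: exI[of _ "\<lambda>x h. f' x h * inverse (f x)"])
qed

lemma smooth_on_cong: "smooth_on S f \<Longrightarrow> (\<And>x. x \<in> S \<Longrightarrow> f x = g x) \<Longrightarrow> smooth_on S g"
  unfolding smooth_on_def using Ck_on_cong by blast

lemma smooth_on_const: "smooth_on S (\<lambda>x. c)"
  and smooth_on_add: "smooth_on S f \<Longrightarrow> smooth_on S g \<Longrightarrow> smooth_on S (\<lambda>x. f x + g x)"
  and smooth_on_bounded_linear: "bounded_linear l \<Longrightarrow> smooth_on S f \<Longrightarrow> smooth_on S (\<lambda>x. l (f x))"
  and smooth_on_imp_continuous_on: "smooth_on S f \<Longrightarrow> continuous_on S f"
  by (auto simp: smooth_on_def intro: Ck_on_const Ck_on_add Ck_on_bounded_linear dest: spec[of _ 0])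

context
  fixes f g :: "'a::euclidean_space \<Rightarrow> real"
begin

lemma smooth_on_mult: "smooth_on S f \<Longrightarrow> smooth_on S g \<Longrightarrow> smooth_on S (\<lambda>x. f x * g x)"
  and smooth_on_inverse:
    "(\<And>x. x \<in> S \<Longrightarrow> f x \<noteq> 0) \<Longrightarrow> smooth_on S f \<Longrightarrow> smooth_on S (\<lambda>x. inverse (f x))"
  and smooth_on_ln: "(\<And>x. x \<in> S \<Longrightarrow> f x > 0) \<Longrightarrow> smooth_on S f \<Longrightarrow> smooth_on S (\<lambda>x. ln (f x))"
  by (simp_all add: smooth_on_def Ck_on_mult Ck_on_inverse Ck_on_ln)

lemma smooth_on_minus: "smooth_on S f \<Longrightarrow> smooth_on S (\<lambda>x. - f x)"
  by (rule smooth_on_bounded_linear[OF bounded_linear_minus[OF bounded_linear_ident]])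

end

lemma smooth_on_diff:
  fixes f g :: "'a::euclidean_space \<Rightarrow> real"
  shows "smooth_on S f \<Longrightarrow> smooth_on S g \<Longrightarrow> smooth_on S (\<lambda>x. f x - g x)"
  using smooth_on_add[of S f "\<lambda>x. - g x"] smooth_on_minus[of S g] by simp

lemma smooth_on_divide:
  fixes f g :: "'a::euclidean_space \<Rightarrow> real"
  shows "(\<And>x. x \<in> S \<Longrightarrow> g x \<noteq> 0) \<Longrightarrow> smooth_on S f \<Longrightarrow> smooth_on S g \<Longrightarrow> smooth_on S (\<lambda>x. f x / g x)"
  unfolding divide_inverse by (intro smooth_on_mult smooth_on_inverse)

lemma smooth_on_sum:
  "(\<And>i. i \<in> I \<Longrightarrow> smooth_on S (f i)) \<Longrightarrow> smooth_on S (\<lambda>x. \<Sum>i\<in>I. f i x)"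
proof (induction I rule: infinite_finite_induct)
  case (insert i I)
  then show ?case by (simp add: smooth_on_add)
qed (simp_all add: smooth_on_const)

section \<open>Integrals of periodic functions over a cell\<close>

text \<open>
  The shifted cell is cut by the hyperplane \<open>x $ i = L $ i\<close>; the part beyond it is moved back by one
  period and fills the gap that the shift left in the cell.
\<close>

lemma integral_periodic_shift:
  fixes g :: "real^3 \<Rightarrow> real"
  assumes g: "continuous_on UNIV g" and per: "box_periodic L g"
    and L: "\<And>i. L $ i > 0" and s: "0 \<le> s" "s \<le> L $ i"
  shows "integral (cbox 0 L) (\<lambda>x. g (x + axis i s)) = integral (cbox 0 L) g"
proof -
  have int: "g integrable_on cbox a b" for a b
    using g continuous_on_subset integrable_continuous by blast
  have e: "axis i (1::real) \<in> Basis" by (simp add: axis_in_Basis_iff)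
  have ax: "x \<bullet> axis i 1 = x $ i" for x :: "real^3" by (simp add: inner_axis)
  let ?l = "axis i (L $ i)" and ?s = "axis i s"
  have "integral (cbox 0 L) (\<lambda>x. g (x + ?s)) = integral (cbox ?s (L + ?s)) g"
    using integral_shift_cbox_plus[of 0 L g ?s] by (simp add: o_def add.commute)
  also have "\<dots> = integral (cbox ?s (L + ?s) \<inter> {x. x $ i \<le> L $ i}) g
      + integral (cbox ?s (L + ?s) \<inter> {x. x $ i \<ge> L $ i}) g"
    using integral_split[OF int e, of ?s "L + ?s" "L $ i"] by (simp add: ax)
  also have "cbox ?s (L + ?s) \<inter> {x. x $ i \<le> L $ i} = cbox 0 L \<inter> {x. x $ i \<ge> s}"
    using s L by (auto simp: mem_box_cart axis_def split: if_splits) (smt (verit))+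
  also have "cbox ?s (L + ?s) \<inter> {x. x $ i \<ge> L $ i} = cbox (0 + ?l) (L - axis i (L $ i - s) + ?l)"
    using s L by (auto simp: mem_box_cart axis_def split: if_splits) (smt (verit))+
  also have "integral (cbox (0 + ?l) (L - axis i (L $ i - s) + ?l)) g
      = integral (cbox 0 (L - axis i (L $ i - s))) g"
    using per unfolding integral_shift_cbox_plus[symmetric]
    by (simp add: o_def box_periodic_def add.commute)
  also have "cbox 0 (L - axis i (L $ i - s)) = cbox 0 L \<inter> {x. x $ i \<le> s}"
    using s L by (auto simp: mem_box_cart axis_def split: if_splits) (smt (verit))+
  also have "integral (cbox 0 L \<inter> {x. x $ i \<ge> s}) g + integral (cbox 0 L \<inter> {x. x $ i \<le> s}) g
      = integral (cbox 0 L) g"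
    using integral_split[OF int e, of 0 L s] by (simp add: ax)
  finally show ?thesis .
qed

text \<open>
  Here and below this takes the place of the divergence theorem.  The integral of
  \<open>x \<mapsto> g (x + axis i s)\<close> over the cell does not depend on \<open>s\<close>, so its derivative at \<open>s = 0\<close>,
  which is the integral of the partial derivative, vanishes.
\<close>

lemma integral_periodic_partial_zero:
  fixes g g' :: "real^3 \<Rightarrow> real"
  assumes g: "continuous_on UNIV g" and per: "box_periodic L g" and L: "\<And>i. L $ i > 0"
    and g': "continuous_on UNIV g'"
    and D: "\<And>x s. ((\<lambda>s. g (x + axis i s)) has_real_derivative g' (x + axis i s)) (at s)"
  shows "integral (cbox 0 L) g' = 0"
proof -
  let ?I = "{0..L $ i}"
  have sc: "axis i s = s *\<^sub>R axis i (1::real)" for s by (simp add: axis_def vec_eq_iff)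
  have "((\<lambda>s. integral (cbox 0 L) (\<lambda>x. g (x + axis i s))) has_real_derivative
      integral (cbox 0 L) (\<lambda>x. g' (x + axis i 0))) (at 0 within ?I)"
  proof (rule leibniz_rule_field_derivative)
    show "((\<lambda>s. g (x + axis i s)) has_real_derivative g' (x + axis i s)) (at s within ?I)" for s x
      using D has_field_derivative_at_within by blast
    show "(\<lambda>x. g (x + axis i s)) integrable_on cbox 0 L" for s
      by (intro integrable_continuous continuous_on_compose2[OF g] continuous_intros) auto
    show "continuous_on (?I \<times> cbox 0 L) (\<lambda>(s, x). g' (x + axis i s))"
      unfolding split_beta by (subst sc) (intro continuous_on_compose2[OF g'] continuous_intros, auto)
  qed (use L[of i] in auto)
  moreover have "((\<lambda>s. integral (cbox 0 L) (\<lambda>x. g (x + axis i s))) has_real_derivative 0) (at 0 within ?I)"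
  proof (rule has_field_derivative_transform_within)
    show "((\<lambda>s. integral (cbox 0 L) g) has_real_derivative 0) (at 0 within ?I)" by simp
  qed (use integral_periodic_shift[OF g per L] L[of i] in \<open>auto intro: zero_less_one\<close>)
  moreover have "at (0::real) within ?I \<noteq> bot"
    using L[of i] by (simp add: trivial_limit_within islimpt_Icc)
  ultimately have "integral (cbox 0 L) (\<lambda>x. g' (x + axis i 0)) = 0"
    by (metis has_real_derivative_iff_has_vector_derivative vector_derivative_unique_within)
  then show ?thesis using sc[of 0] by simp
qed

section \<open>Partial derivatives on the space-time slab\<close>

type_synonym spacetime = "real \<times> (real ^ 3)"

locale slab =
  fixes T :: real
  assumes T_pos: "T > 0"
begin

text \<open>
  The slab contains its bottom face \<open>t = 0\<close>, where derivatives are one-sided in time.  Derivatives are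
  set to \<open>0\<close> outside the slab.  The rules of calculus then hold as equations between
  functions, without a membership condition, so that they also rewrite below a second derivative.
\<close>

definition S :: "spacetime set" where "S = {0..<T} \<times> UNIV"

abbreviation sm :: "(spacetime \<Rightarrow> real) \<Rightarrow> bool" where "sm \<equiv> smooth_on S"

definition pd :: "spacetime \<Rightarrow> (spacetime \<Rightarrow> real) \<Rightarrow> spacetime \<Rightarrow> real" where
  "pd v f z = (if z \<in> S then frechet_derivative f (at z within S) v else 0)"

abbreviation dt :: "(spacetime \<Rightarrow> real) \<Rightarrow> spacetime \<Rightarrow> real" where
  "dt \<equiv> pd (1, 0)"

abbreviation dx :: "3 \<Rightarrow> (spacetime \<Rightarrow> real) \<Rightarrow> spacetime \<Rightarrow> real" where
  "dx i \<equiv> pd (0, axis i 1)"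

lemma mem_S: "(t, x) \<in> S \<longleftrightarrow> 0 \<le> t \<and> t < T"
  by (auto simp: S_def)

text \<open>
  At every point of the slab there is room to move a little forward in each coordinate direction, also on
  the bottom face; hence derivatives within the slab are unique.
\<close>

lemma has_derivative_unique_slab:
  fixes f :: "spacetime \<Rightarrow> 'b::real_normed_vector"
  assumes "(f has_derivative f') (at z within S)" "(f has_derivative f'') (at z within S)" and z: "z \<in> S"
  shows "f' = f''"
proof (rule frechet_derivative_unique_within[OF assms(1,2)])
  fix i :: "spacetime" and e :: real
  assume i: "i \<in> Basis" and e: "e > 0"
  obtain t x where zz: "z = (t, x)" by (cases z)
  define d where "d = min (e / 2) ((T - t) / 2)"
  have "fst i = 0 \<or> fst i = 1" using i by (auto simp: Basis_prod_def)
  then show "\<exists>d. 0 < \<bar>d\<bar> \<and> \<bar>d\<bar> < e \<and> z + d *\<^sub>R i \<in> S"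
    using z e by (intro exI[of _ d], cases i) (auto simp: zz mem_S d_def min_def field_simps)
qed

lemma pd_eqI:
  assumes "(f has_derivative f') (at z within S)" "z \<in> S"
  shows "pd v f z = f' v"
proof -
  have "(f has_derivative frechet_derivative f (at z within S)) (at z within S)"
    using assms(1) frechet_derivative_works differentiableI by blast
  from has_derivative_unique_slab[OF this assms] assms(2) show ?thesis
    by (simp add: pd_def)
qed

lemma sm_has_derivative:
  assumes "sm f" "z \<in> S"
  shows "(f has_derivative (\<lambda>v. pd v f z)) (at z within S)"
proof -
  have "Ck_on (Suc 0) S f" using assms smooth_on_def by blast
  then obtain f' where "(f has_derivative f' z) (at z within S)" using assms by auto
  with pd_eqI[OF this] assms show ?thesis by presburger
qed

lemma sm_pd [simp, intro]:
  assumes "sm f"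
  shows "sm (pd v f)"
  unfolding smooth_on_def
proof
  fix k
  have "Ck_on (Suc k) S f" using assms smooth_on_def by blast
  then obtain f' where f': "\<forall>z\<in>S. (f has_derivative f' z) (at z within S)" "\<forall>v. Ck_on k S (\<lambda>z. f' z v)"
    by auto
  show "Ck_on k S (pd v f)"
    by (rule Ck_on_cong[OF f'(2)[rule_format, of v]]) (rule pd_eqI[OF bspec[OF f'(1)], symmetric])
qed

lemma pd_outside: "z \<notin> S \<Longrightarrow> pd v f z = 0"
  by (simp add: pd_def)

lemma pd_cong:
  assumes "\<And>z. z \<in> S \<Longrightarrow> f z = g z"
  shows "pd v f = pd v g"
proof
  fix z
  have "(f has_derivative f') (at z within S) \<longleftrightarrow> (g has_derivative f') (at z within S)" if "z \<in> S" for f'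
    using assms that has_derivative_transform by metis
  then show "pd v f z = pd v g z"
    by (simp add: pd_def frechet_derivative_def)
qed

lemma pd_eqI_fun:
  assumes "\<And>z. z \<in> S \<Longrightarrow> (f has_derivative (\<lambda>v. f' v z)) (at z within S)"
    and "\<And>v z. z \<notin> S \<Longrightarrow> f' v z = 0"
  shows "pd v f = f' v"
  using assms pd_eqI pd_outside by (intro ext) metis

lemma sm_const [simp, intro]: "sm (\<lambda>z. c)"
  and sm_add [simp, intro]: "sm f \<Longrightarrow> sm g \<Longrightarrow> sm (\<lambda>z. f z + g z)"
  and sm_diff [simp, intro]: "sm f \<Longrightarrow> sm g \<Longrightarrow> sm (\<lambda>z. f z - g z)"
  and sm_minus [simp, intro]: "sm f \<Longrightarrow> sm (\<lambda>z. - f z)"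
  and sm_mult [simp, intro]: "sm f \<Longrightarrow> sm g \<Longrightarrow> sm (\<lambda>z. f z * g z)"
  and sm_ln [simp, intro]: "(\<And>z. z \<in> S \<Longrightarrow> h z > 0) \<Longrightarrow> sm h \<Longrightarrow> sm (\<lambda>z. ln (h z))"
  and sm_divide [simp, intro]: "(\<And>z. z \<in> S \<Longrightarrow> h z > 0) \<Longrightarrow> sm f \<Longrightarrow> sm h \<Longrightarrow> sm (\<lambda>z. f z / h z)"
  and sm_sum [simp, intro]: "(\<And>i. i \<in> I \<Longrightarrow> sm (F i)) \<Longrightarrow> sm (\<lambda>z. \<Sum>i\<in>I. F i z)"
  by (blast intro: smooth_on_const smooth_on_add smooth_on_diff smooth_on_minus smooth_on_mult
      smooth_on_ln)+
    ((rule smooth_on_divide; force), (rule smooth_on_sum; simp))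

lemma sm_power2 [simp, intro]: "sm f \<Longrightarrow> sm (\<lambda>z. (f z)\<^sup>2)"
  unfolding power2_eq_square by (rule sm_mult)

lemma pd_const [simp]: "pd v (\<lambda>z. c) = (\<lambda>z. 0)"
  by (rule pd_eqI_fun) auto

lemma pd_add: "sm f \<Longrightarrow> sm g \<Longrightarrow> pd v (\<lambda>z. f z + g z) = (\<lambda>z. pd v f z + pd v g z)"
  by (rule pd_eqI_fun) (auto intro!: derivative_eq_intros sm_has_derivative simp: pd_outside)

lemma pd_diff: "sm f \<Longrightarrow> sm g \<Longrightarrow> pd v (\<lambda>z. f z - g z) = (\<lambda>z. pd v f z - pd v g z)"
  by (rule pd_eqI_fun) (auto intro!: derivative_eq_intros sm_has_derivative simp: pd_outside)

lemma pd_minus: "sm f \<Longrightarrow> pd v (\<lambda>z. - f z) = (\<lambda>z. - pd v f z)"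
  by (rule pd_eqI_fun) (auto intro!: derivative_eq_intros sm_has_derivative simp: pd_outside)

lemma pd_mult: "sm f \<Longrightarrow> sm g \<Longrightarrow> pd v (\<lambda>z. f z * g z) = (\<lambda>z. pd v f z * g z + f z * pd v g z)"
  by (rule pd_eqI_fun)
    (auto intro!: derivative_eq_intros sm_has_derivative simp: pd_outside)

lemma pd_power2: "sm f \<Longrightarrow> pd v (\<lambda>z. (f z)\<^sup>2) = (\<lambda>z. 2 * f z * pd v f z)"
  by (simp add: power2_eq_square pd_mult algebra_simps)

lemma pd_sum:
  "(\<And>i. i \<in> I \<Longrightarrow> sm (F i)) \<Longrightarrow> pd v (\<lambda>z. \<Sum>i\<in>I. F i z) = (\<lambda>z. \<Sum>i\<in>I. pd v (F i) z)"
  by (rule pd_eqI_fun) (auto intro!: has_derivative_sum sm_has_derivative simp: pd_outside)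

lemma pd_ln:
  assumes "\<And>z. z \<in> S \<Longrightarrow> h z > 0" "sm h"
  shows "pd v (\<lambda>z. ln (h z)) = (\<lambda>z. pd v h z / h z)"
  by (rule pd_eqI_fun)
    (auto intro!: has_derivative_ln sm_has_derivative assms simp: pd_outside divide_inverse)

lemma pd_divide:
  assumes "\<And>z. z \<in> S \<Longrightarrow> h z > 0" "sm f" "sm h"
  shows "pd v (\<lambda>z. f z / h z) = (\<lambda>z. (pd v f z - f z / h z * pd v h z) / h z)"
proof (rule pd_eqI_fun)
  fix z assume z: "z \<in> S"
  have "h z \<noteq> 0" using assms(1)[OF z] by simp
  then show "((\<lambda>z. f z / h z) has_derivative (\<lambda>v. (pd v f z - f z / h z * pd v h z) / h z)) (at z within S)"
    by (auto intro!: derivative_eq_intros sm_has_derivative assms z simp: field_simps)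
qed (simp add: pd_outside)

lemma pd_divide_const: "sm f \<Longrightarrow> pd v (\<lambda>z. f z / c) = (\<lambda>z. pd v f z / c)"
  unfolding divide_inverse by (simp add: pd_mult)

lemma pd_lincomb: "sm f \<Longrightarrow> sm g \<Longrightarrow> pd v (\<lambda>z. a * f z + b * g z) = (\<lambda>z. a * pd v f z + b * pd v g z)"
  by (simp add: pd_add pd_mult)

lemma pd_scale:
  assumes "sm f"
  shows "pd (c *\<^sub>R v) f z = c * pd v f z"
proof (cases "z \<in> S")
  case True
  from has_derivative_linear[OF sm_has_derivative[OF assms True]] show ?thesis
    using linear_scale by fastforce
qed (simp add: pd_outside)

lemma sm_line:
  assumes f: "sm f" and I: "\<And>s. s \<in> I \<Longrightarrow> z + s *\<^sub>R v \<in> S" and s: "s \<in> I"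
  shows "((\<lambda>s. f (z + s *\<^sub>R v)) has_real_derivative pd v f (z + s *\<^sub>R v)) (at s within I)"
proof -
  have "((\<lambda>s. z + s *\<^sub>R v) has_derivative (\<lambda>h. h *\<^sub>R v)) (at s within I)"
    by (auto intro!: derivative_eq_intros)
  moreover have "(f has_derivative (\<lambda>w. pd w f (z + s *\<^sub>R v)))
      (at (z + s *\<^sub>R v) within (\<lambda>s. z + s *\<^sub>R v) ` I)"
    by (rule has_derivative_subset[OF sm_has_derivative[OF f I[OF s]]]) (use I in blast)
  ultimately have "((\<lambda>s. f (z + s *\<^sub>R v)) has_derivative (\<lambda>h. pd (h *\<^sub>R v) f (z + s *\<^sub>R v))) (at s within I)"
    by (rule has_derivative_in_compose)
  then show ?thesis
    by (simp add: pd_scale[OF f] has_field_derivative_def mult_commute_abs)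
qed

lemma sm_slice_time:
  assumes "sm f" "t \<in> {0..<T}"
  shows "((\<lambda>s. f (s, x)) has_real_derivative dt f (t, x)) (at t within {0..<T})"
  using sm_line[of f "{0..<T}" "(0, x)" "(1, 0)" t] assms by (simp add: mem_S)

lemma sm_slice_space:
  assumes "sm f" "t \<in> {0..<T}"
  shows "((\<lambda>y. f (t, y)) has_derivative (\<lambda>h. pd (0, h) f (t, x))) (at x)"
proof -
  have "(Pair t has_derivative (\<lambda>h. (0, h))) (at x)"
    by (auto intro!: derivative_eq_intros)
  moreover have "(f has_derivative (\<lambda>w. pd w f (t, x))) (at (Pair t x) within range (Pair t))"
    by (rule has_derivative_subset[OF sm_has_derivative[OF assms(1)]]) (use assms(2) in \<open>auto simp: mem_S\<close>)
  ultimately show ?thesis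
    by (rule has_derivative_in_compose)
qed

lemma sm_continuous_slice:
  assumes "sm f" "t \<in> {0..<T}"
  shows "continuous_on A (\<lambda>x. f (t, x))"
  by (rule continuous_on_compose2[OF smooth_on_imp_continuous_on[OF assms(1)]])
    (use assms(2) in \<open>auto intro!: continuous_intros simp: mem_S\<close>)

text \<open>
  Schwarz's theorem in a form that reaches the boundary: only the parallelogram spanned by small nonnegative
  multiples of \<open>v\<close> and \<open>w\<close> has to stay in the slab.  The increment of \<open>f\<close> along \<open>v\<close> is the integral of
  its \<open>v\<close>-derivative; differentiating in direction \<open>w\<close> under the integral sign shows that both mixed
  derivatives have the same integrals along the segments from \<open>z\<close>, hence the same value at \<open>z\<close>.
\<close>

lemma pd_commute_at:
  assumes f: "sm f" and z: "z \<in> S" and \<delta>: "\<delta> > 0"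
    and stay: "\<And>a b. 0 \<le> a \<Longrightarrow> a \<le> \<delta> \<Longrightarrow> 0 \<le> b \<Longrightarrow> b \<le> \<delta> \<Longrightarrow> z + a *\<^sub>R v + b *\<^sub>R w \<in> S"
  shows "pd v (pd w f) z = pd w (pd v f) z"
proof -
  have stay1: "z + a *\<^sub>R v \<in> S" if "0 \<le> a" "a \<le> \<delta>" for a
    using stay[of a 0] that \<delta> by simp
  have nontriv: "at 0 within {0..\<delta>} \<noteq> bot"
    using \<delta> by (simp add: trivial_limit_within islimpt_Icc)
  have unique0: "a = b" if "(F has_real_derivative a) (at 0 within {0..\<delta>})" 
    "(F has_real_derivative b) (at 0 within {0..\<delta>})" for F a b
    using that vector_derivative_unique_within[OF nontriv]
    by (simp add: has_real_derivative_iff_has_vector_derivative)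
  have cont: "continuous_on A (\<lambda>s. g (q s))" if "sm g" "continuous_on A q" "\<And>s. s \<in> A \<Longrightarrow> q s \<in> S"
    for g :: "spacetime \<Rightarrow> real" and q and A :: "'c::topological_space set"
    by (rule continuous_on_compose2[OF smooth_on_imp_continuous_on]) (use that in auto)
  have FTC: "((\<lambda>a. pd v g (z' + a *\<^sub>R v)) has_integral g (z' + s *\<^sub>R v) - g z') (cbox 0 s)"
    if "sm g" "0 \<le> s" "\<And>a. 0 \<le> a \<Longrightarrow> a \<le> s \<Longrightarrow> z' + a *\<^sub>R v \<in> S" for g s z'
    using fundamental_theorem_of_calculus[OF that(2), of "\<lambda>a. g (z' + a *\<^sub>R v)" "\<lambda>a. pd v g (z' + a *\<^sub>R v)"]
      sm_line[OF that(1), of "{0..s}" z' v] that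
    by (auto simp: has_real_derivative_iff_has_vector_derivative[symmetric])
  have eq: "integral {0..s} (\<lambda>a. pd v (pd w f) (z + a *\<^sub>R v)) = integral {0..s} (\<lambda>a. pd w (pd v f) (z + a *\<^sub>R v))"
    if s: "s \<in> {0..\<delta>}" for s
  proof -
    let ?J = "\<lambda>b. integral (cbox 0 s) (\<lambda>a. pd v f ((z + a *\<^sub>R v) + b *\<^sub>R w))"
    have J1: "(?J has_real_derivative integral (cbox 0 s) (\<lambda>a. pd w (pd v f) ((z + a *\<^sub>R v) + 0 *\<^sub>R w)))
        (at 0 within {0..\<delta>})"
    proof (rule leibniz_rule_field_derivative)
      show "((\<lambda>b. pd v f (z + a *\<^sub>R v + b *\<^sub>R w)) has_real_derivative pd w (pd v f) (z + a *\<^sub>R v + b *\<^sub>R w))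
          (at b within {0..\<delta>})" if "b \<in> {0..\<delta>}" "a \<in> cbox 0 s" for a b
        using that s by (intro sm_line sm_pd f) (auto intro!: stay)
      show "(\<lambda>a. pd v f (z + a *\<^sub>R v + b *\<^sub>R w)) integrable_on cbox 0 s" if "b \<in> {0..\<delta>}" for b
        using that s by (intro integrable_continuous cont sm_pd f continuous_intros) (auto intro!: stay)
      show "continuous_on ({0..\<delta>} \<times> cbox 0 s) (\<lambda>(b, a). pd w (pd v f) (z + a *\<^sub>R v + b *\<^sub>R w))"
        unfolding split_beta using s by (intro cont sm_pd f continuous_intros) (auto intro!: stay)
    qed (use \<delta> in auto)
    have J2: "((\<lambda>b. f ((z + s *\<^sub>R v) + b *\<^sub>R w) - f (z + b *\<^sub>R w)) has_real_derivative
        pd w f ((z + s *\<^sub>R v) + 0 *\<^sub>R w) - pd w f (z + 0 *\<^sub>R w)) (at 0 within {0..\<delta>})"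
      using s \<delta> stay[of 0] by (intro derivative_intros sm_line f) (auto intro!: stay)
    have J3: "?J b = f ((z + s *\<^sub>R v) + b *\<^sub>R w) - f (z + b *\<^sub>R w)" if "b \<in> {0..\<delta>}" for b
      using FTC[OF f, of s "z + b *\<^sub>R w"] s that stay
      by (simp add: integral_unique algebra_simps)
    have "(?J has_real_derivative
        pd w f ((z + s *\<^sub>R v) + 0 *\<^sub>R w) - pd w f (z + 0 *\<^sub>R w)) (at 0 within {0..\<delta>})"
      by (rule has_field_derivative_transform_within[OF J2, where d = 1]) (use J3 \<delta> in auto)
    with J1 have "integral (cbox 0 s) (\<lambda>a. pd w (pd v f) ((z + a *\<^sub>R v) + 0 *\<^sub>R w))
        = pd w f ((z + s *\<^sub>R v) + 0 *\<^sub>R w) - pd w f (z + 0 *\<^sub>R w)"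
      by (rule unique0)
    also have "\<dots> = integral (cbox 0 s) (\<lambda>a. pd v (pd w f) (z + a *\<^sub>R v))"
      using FTC[OF sm_pd[OF f], of s z w] s stay1 by (simp add: integral_unique)
    finally show ?thesis by simp
  qed
  have der: "((\<lambda>s. integral {0..s} (\<lambda>a. g (z + a *\<^sub>R v))) has_vector_derivative g (z + 0 *\<^sub>R v)) (at 0 within {0..\<delta>})"
    if "sm g" for g
    using \<delta> by (intro integral_has_vector_derivative cont that continuous_intros) (auto intro!: stay1)
  have "((\<lambda>s. integral {0..s} (\<lambda>a. pd w (pd v f) (z + a *\<^sub>R v))) has_vector_derivative
      pd v (pd w f) (z + 0 *\<^sub>R v)) (at 0 within {0..\<delta>})"
    by (rule has_vector_derivative_transform[OF _ _ der]) (use \<delta> eq f in auto)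
  from vector_derivative_unique_within[OF _ this der] nontriv f show ?thesis
    by simp
qed

lemma pd_commute:
  assumes f: "sm f" and v: "fst v \<ge> 0" and w: "fst w \<ge> 0"
  shows "pd v (pd w f) = pd w (pd v f)"
proof
  fix z
  show "pd v (pd w f) z = pd w (pd v f) z"
  proof (cases "z \<in> S")
    case True
    obtain t x where z: "z = (t, x)" by (cases z)
    \<comment> \<open>Nonnegative time components can leave the slab only through the top \<open>t = T\<close>; this \<open>\<delta>\<close> uses up
      at most half of the remaining time.\<close>
    define \<delta> where "\<delta> = (T - t) / (2 * (fst v + fst w + 1))"
    have t: "0 \<le> t" "t < T" using True z by (auto simp: mem_S)
    then have \<delta>: "\<delta> > 0" using v w by (simp add: \<delta>_def)
    have "t + a * fst v + b * fst w < T" if "a \<le> \<delta>" "b \<le> \<delta>" for a b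
    proof -
      have "a * fst v \<le> \<delta> * fst v" "b * fst w \<le> \<delta> * fst w"
        using that v w by (auto intro: mult_right_mono)
      moreover have "\<delta> * (fst v + fst w + 1) = (T - t) / 2"
        using v w by (simp add: \<delta>_def field_simps)
      ultimately show ?thesis using t \<delta> by (simp add: algebra_simps)
    qed
    then show ?thesis
      using t v w by (intro pd_commute_at[OF f True \<delta>], cases v, cases w) (auto simp: z mem_S)
  qed (simp add: pd_outside)
qed

definition per :: "real^3 \<Rightarrow> (spacetime \<Rightarrow> real) \<Rightarrow> bool" where
  "per L f \<longleftrightarrow> (\<forall>t\<in>{0..<T}. box_periodic L (\<lambda>x. f (t, x)))"

lemma per_pd [simp, intro]:
  assumes f: "sm f" and "per L f"
  shows "per L (pd v f)"
proof -
  have "pd v f (t, x + axis i (L $ i)) = pd v f (t, x)" if t: "t \<in> {0..<T}" for t x i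
  proof -
    let ?\<tau> = "\<lambda>z. z + (0, axis i (L $ i))"
    have "(f has_derivative (\<lambda>w. pd w f (?\<tau> (t, x)))) (at (?\<tau> (t, x)) within ?\<tau> ` S)"
      using t by (intro has_derivative_subset[OF sm_has_derivative[OF f]]) (auto simp: S_def)
    moreover have "(?\<tau> has_derivative (\<lambda>h. h)) (at (t, x) within S)"
      by (auto intro!: derivative_eq_intros)
    ultimately have "((\<lambda>z. f (?\<tau> z)) has_derivative (\<lambda>h. pd h f (?\<tau> (t, x)))) (at (t, x) within S)"
      by (rule has_derivative_in_compose[rotated])
    then have "pd v (\<lambda>z. f (?\<tau> z)) (t, x) = pd v f (?\<tau> (t, x))"
      using t by (intro pd_eqI) (auto simp: mem_S)
    moreover have "pd v (\<lambda>z. f (?\<tau> z)) = pd v f"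
      using assms(2) by (intro pd_cong) (auto simp: per_def box_periodic_def S_def)
    ultimately show ?thesis by simp
  qed
  then show ?thesis by (simp add: per_def box_periodic_def)
qed

lemma per_combine [simp, intro]:
  "per L (\<lambda>z. c)"
  "per L f \<Longrightarrow> per L g \<Longrightarrow> per L (\<lambda>z. f z + g z)"
  "per L f \<Longrightarrow> per L g \<Longrightarrow> per L (\<lambda>z. f z - g z)"
  "per L f \<Longrightarrow> per L (\<lambda>z. - f z)"
  "per L f \<Longrightarrow> per L g \<Longrightarrow> per L (\<lambda>z. f z * g z)"
  "per L f \<Longrightarrow> per L g \<Longrightarrow> per L (\<lambda>z. f z / g z)"
  "per L f \<Longrightarrow> per L (\<lambda>z. ln (f z))"
  "per L f \<Longrightarrow> per L (\<lambda>z. (f z)\<^sup>2)"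
  "(\<And>i. i \<in> I \<Longrightarrow> per L (F i)) \<Longrightarrow> per L (\<lambda>z. \<Sum>i\<in>I. F i z)"
  by (auto simp: per_def box_periodic_def)

lemma sm_slice_axis:
  assumes f: "sm f" and t: "t \<in> {0..<T}"
  shows "((\<lambda>s. f (t, x + axis i s)) has_real_derivative dx i f (t, x + axis i s)) (at s)"
proof -
  define e where "e = axis i (1::real)"
  have "axis i s = s *\<^sub>R e" for s by (simp add: e_def axis_def vec_eq_iff)
  then show ?thesis
    using sm_line[OF f, of UNIV "(t, x)" "(0, e)" s] t by (simp add: mem_S)
qed

lemma integral_dx_zero:
  assumes f: "sm f" "per L f" and L: "\<And>i. L $ i > 0" and t: "t \<in> {0..<T}"
  shows "integral (cbox 0 L) (\<lambda>x. dx i f (t, x)) = 0"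
  by (rule integral_periodic_partial_zero[where g = "\<lambda>x. f (t, x)" and i = i])
    (use assms sm_continuous_slice sm_slice_axis in \<open>auto simp: per_def\<close>)

lemma integral_dt:
  assumes f: "sm f" and t: "t \<in> {0..<T}"
  shows "((\<lambda>s. integral (cbox 0 L) (\<lambda>x. f (s, x))) has_real_derivative
    integral (cbox 0 L) (\<lambda>x. dt f (t, x))) (at t within {0..<T})"
proof (rule leibniz_rule_field_derivative)
  show "continuous_on ({0..<T} \<times> cbox 0 L) (\<lambda>(s, x). dt f (s, x))"
    by (simp, rule continuous_on_subset[OF smooth_on_imp_continuous_on[OF sm_pd[OF f]]]) (auto simp: S_def)
qed (use f t in \<open>auto intro!: sm_slice_time integrable_continuous sm_continuous_slice\<close>)

lemma integral_slice_add:
  assumes "sm f" "sm g" "t \<in> {0..<T}"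
  shows "integral (cbox a b) (\<lambda>x. f (t, x) + g (t, x))
    = integral (cbox a b) (\<lambda>x. f (t, x)) + integral (cbox a b) (\<lambda>x. g (t, x))"
  using assms by (intro integral_add integrable_continuous sm_continuous_slice)

lemma integral_slice_diff:
  assumes "sm f" "sm g" "t \<in> {0..<T}"
  shows "integral (cbox a b) (\<lambda>x. f (t, x) - g (t, x))
    = integral (cbox a b) (\<lambda>x. f (t, x)) - integral (cbox a b) (\<lambda>x. g (t, x))"
  using assms by (intro integral_diff integrable_continuous sm_continuous_slice)

end

section \<open>Equality up to the divergence of a periodic flux\<close>

context slab
begin

text \<open>
  Two densities that agree up to the divergence of a smooth periodic flux have the same integral over the
  cell.  In this relation integration by parts becomes a pointwise identity (the product rule), so the
  energy balance can be derived locally and integrated once.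
\<close>

definition eq_mod_div :: "real^3 \<Rightarrow> (spacetime \<Rightarrow> real) \<Rightarrow> (spacetime \<Rightarrow> real) \<Rightarrow> bool" where
  "eq_mod_div L f g \<longleftrightarrow> (\<exists>K. (\<forall>j. sm (K j) \<and> per L (K j)) \<and>
     (\<forall>z\<in>S. f z = g z + (\<Sum>j\<in>UNIV. dx j (K j) z)))"

lemma eq_mod_divI:
  "(\<And>j. sm (K j)) \<Longrightarrow> (\<And>j. per L (K j)) \<Longrightarrow>
   (\<And>z. z \<in> S \<Longrightarrow> f z = g z + (\<Sum>j\<in>UNIV. dx j (K j) z)) \<Longrightarrow> eq_mod_div L f g"
  unfolding eq_mod_div_def by blast

lemma eq_mod_div_eq: "(\<And>z. z \<in> S \<Longrightarrow> f z = g z) \<Longrightarrow> eq_mod_div L f g"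
  by (rule eq_mod_divI[where K = "\<lambda>_ _. 0"]) auto

lemma eq_mod_div_lincomb:
  assumes "eq_mod_div L f g" "eq_mod_div L f' g'"
  shows "eq_mod_div L (\<lambda>z. a * f z + b * f' z) (\<lambda>z. a * g z + b * g' z)"
proof -
  obtain K where K: "\<And>j. sm (K j)" "\<And>j. per L (K j)"
    "\<And>z. z \<in> S \<Longrightarrow> f z = g z + (\<Sum>j\<in>UNIV. dx j (K j) z)"
    using assms(1) unfolding eq_mod_div_def by blast
  obtain K' where K': "\<And>j. sm (K' j)" "\<And>j. per L (K' j)"
    "\<And>z. z \<in> S \<Longrightarrow> f' z = g' z + (\<Sum>j\<in>UNIV. dx j (K' j) z)"
    using assms(2) unfolding eq_mod_div_def by blast
  show ?thesis
    by (rule eq_mod_divI[where K = "\<lambda>j z. a * K j z + b * K' j z"])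
      (simp_all add: K K' pd_add pd_mult sum_3 algebra_simps)
qed

lemma eq_mod_div_add:
  "eq_mod_div L f g \<Longrightarrow> eq_mod_div L f' g' \<Longrightarrow> eq_mod_div L (\<lambda>z. f z + f' z) (\<lambda>z. g z + g' z)"
  using eq_mod_div_lincomb[of L f g f' g' 1 1] by simp

lemma eq_mod_div_cmult: "eq_mod_div L f g \<Longrightarrow> eq_mod_div L (\<lambda>z. a * f z) (\<lambda>z. a * g z)"
  using eq_mod_div_lincomb[of L f g "\<lambda>z. 0" "\<lambda>z. 0" a 0] eq_mod_div_eq by simp

lemma eq_mod_div_sum:
  "(\<And>i. i \<in> I \<Longrightarrow> eq_mod_div L (f i) (g i)) \<Longrightarrow>
    eq_mod_div L (\<lambda>z. \<Sum>i\<in>I. f i z) (\<lambda>z. \<Sum>i\<in>I. g i z)"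
  by (induction I rule: infinite_finite_induct) (auto intro: eq_mod_div_add eq_mod_div_eq)

lemma eq_mod_div_trans [trans]:
  assumes "eq_mod_div L f g" "eq_mod_div L g h"
  shows "eq_mod_div L f h"
proof -
  have "eq_mod_div L (\<lambda>z. f z + g z + (- 1) * g z) (\<lambda>z. g z + h z + (- 1) * g z)"
    by (intro eq_mod_div_add assms eq_mod_div_eq refl)
  then show ?thesis by simp
qed

lemma eq_mod_div_sym: "eq_mod_div L f g \<Longrightarrow> eq_mod_div L g f"
  using eq_mod_div_add[of L "\<lambda>z. - f z" "\<lambda>z. - g z" "\<lambda>z. f z + g z" "\<lambda>z. f z + g z"]
    eq_mod_div_cmult[of L f g "-1"] eq_mod_div_eq[of "\<lambda>z. f z + g z"] by simp

lemma eq_mod_div_cong: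
  "eq_mod_div L f g \<Longrightarrow> (\<And>z. z \<in> S \<Longrightarrow> f' z = f z) \<Longrightarrow> (\<And>z. z \<in> S \<Longrightarrow> g' z = g z) \<Longrightarrow> eq_mod_div L f' g'"
  unfolding eq_mod_div_def by auto

lemma eq_mod_div_by_parts:
  assumes "sm f" "per L f" "\<And>j. sm (K j)" "\<And>j. per L (K j)"
  shows "eq_mod_div L (\<lambda>z. f z * (\<Sum>j\<in>UNIV. dx j (K j) z)) (\<lambda>z. - (\<Sum>j\<in>UNIV. dx j f z * K j z))"
  by (rule eq_mod_divI[where K = "\<lambda>j z. f z * K j z"])
    (simp_all add: assms pd_mult sum_3 algebra_simps)

lemma eq_mod_div_integral:
  assumes "eq_mod_div L f g" "sm f" "sm g" and L: "\<And>i. L $ i > 0" and t: "t \<in> {0..<T}"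
  shows "integral (cbox 0 L) (\<lambda>x. f (t, x)) = integral (cbox 0 L) (\<lambda>x. g (t, x))"
proof -
  obtain K where K: "\<And>j. sm (K j)" "\<And>j. per L (K j)"
    "\<And>z. z \<in> S \<Longrightarrow> f z = g z + (\<Sum>j\<in>UNIV. dx j (K j) z)"
    using assms(1) unfolding eq_mod_div_def by blast
  have int: "(\<lambda>x. h (t, x)) integrable_on cbox 0 L" if "sm h" for h
    using that t by (intro integrable_continuous sm_continuous_slice)
  have "integral (cbox 0 L) (\<lambda>x. f (t, x)) = integral (cbox 0 L) (\<lambda>x. g (t, x) + (\<Sum>j\<in>UNIV. dx j (K j) (t, x)))"
    using K(3) t by (intro integral_cong) (simp add: mem_S)
  also have "\<dots> = integral (cbox 0 L) (\<lambda>x. g (t, x)) + integral (cbox 0 L) (\<lambda>x. \<Sum>j\<in>UNIV. dx j (K j) (t, x))"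
    by (intro integral_add integrable_sum int assms sm_pd K finite)
  also have "integral (cbox 0 L) (\<lambda>x. \<Sum>j\<in>UNIV. dx j (K j) (t, x)) = 0"
    using integral_dx_zero[OF K(1,2) L t] by (subst integral_sum) (auto intro!: int K)
  finally show ?thesis by simp
qed

end

section \<open>Transport by a mass-conserving flow\<close>

locale advected = slab +
  fixes L :: "real^3" and R :: "spacetime \<Rightarrow> real" and U :: "3 \<Rightarrow> spacetime \<Rightarrow> real"
  assumes R_sm [simp, intro]: "sm R" and R_per [simp, intro]: "per L R"
    and R_pos: "z \<in> S \<Longrightarrow> R z > 0"
    and U_sm [simp, intro]: "sm (U i)" and U_per [simp, intro]: "per L (U i)"
    and mass: "z \<in> S \<Longrightarrow> dt R z + (\<Sum>j\<in>UNIV. dx j (\<lambda>z. R z * U j z) z) = 0"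
begin

text \<open>
  Divided by \<open>R\<close>, the continuity equation becomes an equation for \<open>ln R\<close> in which the density
  no longer multiplies the divergence of \<open>U\<close>; the gradient of this equation says how the flow carries
  the velocity correction \<open>grad (ln R)\<close>.
\<close>

definition lnR :: "spacetime \<Rightarrow> real" where "lnR z = ln (R z)"

lemma lnR_sm [simp, intro]: "sm lnR" and lnR_per [simp, intro]: "per L lnR"
  unfolding lnR_def[abs_def] using R_pos by auto

lemma pd_R: "pd v R = (\<lambda>z. R z * pd v lnR z)"
proof
  fix z show "pd v R z = R z * pd v lnR z"
    using R_pos[of z] unfolding lnR_def[abs_def]
    by (cases "z \<in> S") (simp_all add: pd_ln[OF R_pos R_sm] pd_outside)
qed

lemma dt_R: "dt R = (\<lambda>z. - (\<Sum>j\<in>UNIV. dx j (\<lambda>z. R z * U j z) z))"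
proof
  fix z show "dt R z = - (\<Sum>j\<in>UNIV. dx j (\<lambda>z. R z * U j z) z)"
    using mass[of z] by (cases "z \<in> S") (simp_all add: pd_outside)
qed

lemma dt_lnR: "dt lnR = (\<lambda>z. - (\<Sum>j\<in>UNIV. U j z * dx j lnR z + dx j (U j) z))"
proof
  fix z show "dt lnR z = - (\<Sum>j\<in>UNIV. U j z * dx j lnR z + dx j (U j) z)"
  proof (cases "z \<in> S")
    case True
    have "R z * (dt lnR z + (\<Sum>j\<in>UNIV. U j z * dx j lnR z + dx j (U j) z)) = 0"
      using fun_cong[OF dt_R, of z] by (simp add: pd_mult pd_R sum_3 algebra_simps)
    with R_pos[OF True] show ?thesis by simp
  qed (simp add: pd_outside)
qed

text \<open>
  The gradient of the equation for \<open>ln R\<close>, multiplied by \<open>R\<close>.  The transposed velocity gradient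
  on the right is what later turns the symmetric gradient in the viscous term into a skew one.
\<close>

lemma grad_lnR_transport:
  "R z * (dt (dx i lnR) z + (\<Sum>j\<in>UNIV. U j z * dx j (dx i lnR) z))
    = - (\<Sum>j\<in>UNIV. dx j (\<lambda>z. R z * dx i (U j) z) z)"
proof -
  have "dt (dx i lnR) = dx i (dt lnR)" by (simp add: pd_commute)
  also have "\<dots> = (\<lambda>z. - (\<Sum>j\<in>UNIV. dx i (U j) z * dx j lnR z + U j z * dx j (dx i lnR) z
      + dx j (dx i (U j)) z))"
    unfolding dt_lnR by (simp add: pd_minus pd_sum pd_add pd_mult pd_commute[of _ "(0, axis i 1)"] algebra_simps)
  finally show ?thesis
    by (simp add: pd_mult pd_R sum_3 algebra_simps)
qed

text \<open>
  The kinetic energy of any field \<open>V\<close> that is carried along by the flow under a force \<open>G\<close> and a stress \<open>N\<close>.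
  The derivative of \<open>R\<close> in the kinetic energy is replaced through the continuity equation, and one
  integration by parts produces exactly the convective terms; another one moves the
  derivative from the stress onto \<open>V\<close>.
\<close>

lemma kinetic_balance:
  fixes V G :: "3 \<Rightarrow> spacetime \<Rightarrow> real" and N :: "3 \<Rightarrow> 3 \<Rightarrow> spacetime \<Rightarrow> real"
  assumes V: "\<And>i. sm (V i)" "\<And>i. per L (V i)" and G: "\<And>i. sm (G i)"
    and N: "\<And>i j. sm (N i j)" "\<And>i j. per L (N i j)"
    and eq: "\<And>i z. z \<in> S \<Longrightarrow> R z * (dt (V i) z + (\<Sum>j\<in>UNIV. U j z * dx j (V i) z))
      = G i z + (\<Sum>j\<in>UNIV. dx j (N i j) z)"
  shows "eq_mod_div L (dt (\<lambda>z. 1/2 * (R z * (\<Sum>i\<in>UNIV. (V i z)\<^sup>2))))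
    (\<lambda>z. (\<Sum>i\<in>UNIV. V i z * G i z) - (\<Sum>i\<in>UNIV. \<Sum>j\<in>UNIV. dx j (V i) z * N i j z))"
proof -
  let ?q = "\<lambda>z. - 1/2 * (\<Sum>i\<in>UNIV. (V i z)\<^sup>2)"
  have "eq_mod_div L (\<lambda>z. ?q z * (\<Sum>j\<in>UNIV. dx j (\<lambda>z. R z * U j z) z))
      (\<lambda>z. - (\<Sum>j\<in>UNIV. dx j ?q z * (R z * U j z)))"
    by (rule eq_mod_div_by_parts) (intro sm_mult sm_const sm_sum sm_power2 per_combine V R_sm R_per U_sm U_per)+
  moreover have "eq_mod_div L (\<lambda>z. \<Sum>i\<in>UNIV. V i z * (\<Sum>j\<in>UNIV. dx j (N i j) z))
      (\<lambda>z. \<Sum>i\<in>UNIV. - (\<Sum>j\<in>UNIV. dx j (V i) z * N i j z))"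
    by (intro eq_mod_div_sum eq_mod_div_by_parts) (auto intro!: V N)
  moreover have "eq_mod_div L (\<lambda>z. (\<Sum>i\<in>UNIV. V i z * G i z) + (\<Sum>j\<in>UNIV. dx j ?q z * (R z * U j z)))
      (\<lambda>z. (\<Sum>i\<in>UNIV. V i z * G i z) + (\<Sum>j\<in>UNIV. dx j ?q z * (R z * U j z)))"
    by (rule eq_mod_div_eq) simp
  ultimately have "eq_mod_div L
      (\<lambda>z. ?q z * (\<Sum>j\<in>UNIV. dx j (\<lambda>z. R z * U j z) z)
        + ((\<Sum>i\<in>UNIV. V i z * (\<Sum>j\<in>UNIV. dx j (N i j) z))
        + ((\<Sum>i\<in>UNIV. V i z * G i z) + (\<Sum>j\<in>UNIV. dx j ?q z * (R z * U j z)))))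
      (\<lambda>z. - (\<Sum>j\<in>UNIV. dx j ?q z * (R z * U j z))
        + ((\<Sum>i\<in>UNIV. - (\<Sum>j\<in>UNIV. dx j (V i) z * N i j z))
        + ((\<Sum>i\<in>UNIV. V i z * G i z) + (\<Sum>j\<in>UNIV. dx j ?q z * (R z * U j z)))))"
    by (intro eq_mod_div_add) (simp_all add: eq_mod_div_eq)
  then show ?thesis
  proof (rule eq_mod_div_cong)
    fix z assume z: "z \<in> S"
    have R: "(\<Sum>j\<in>UNIV. dx j (\<lambda>z. R z * U j z) z) = - dt R z" using mass[OF z] by simp
    have N: "(\<Sum>j\<in>UNIV. dx j (N i j) z) = R z * (dt (V i) z + (\<Sum>j\<in>UNIV. U j z * dx j (V i) z)) - G i z" for i
      using eq[OF z, of i] by simp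
    have q: "pd v ?q z = - (\<Sum>i\<in>UNIV. V i z * pd v (V i) z)" for v
      by (simp add: V pd_mult pd_sum pd_power2 pd_minus pd_divide_const pd_add sum_3) (simp add: field_simps)
    show "dt (\<lambda>z. 1/2 * (R z * (\<Sum>i\<in>UNIV. (V i z)\<^sup>2))) z =
      ?q z * (\<Sum>j\<in>UNIV. dx j (\<lambda>z. R z * U j z) z)
        + ((\<Sum>i\<in>UNIV. V i z * (\<Sum>j\<in>UNIV. dx j (N i j) z))
        + ((\<Sum>i\<in>UNIV. V i z * G i z) + (\<Sum>j\<in>UNIV. dx j ?q z * (R z * U j z))))"
      unfolding R N q by (simp add: V pd_mult pd_sum pd_power2 pd_divide_const pd_add sum_3) (simp add: field_simps)
  qed (simp add: sum_negf)
qed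

end

section \<open>A charged species in a drift-diffusion equation\<close>

locale species = advected +
  fixes A q :: real and C \<Psi> :: "spacetime \<Rightarrow> real"
  assumes C_sm [simp, intro]: "sm C" and C_per [simp, intro]: "per L C"
    and C_pos: "z \<in> S \<Longrightarrow> C z > 0"
    and \<Psi>_sm [simp, intro]: "sm \<Psi>" and \<Psi>_per [simp, intro]: "per L \<Psi>"
    and transport: "z \<in> S \<Longrightarrow> dt C z + (\<Sum>j\<in>UNIV. dx j (\<lambda>z. C z * U j z) z)
      = (\<Sum>j\<in>UNIV. dx j (\<lambda>z. A * dx j C z) z) + (\<Sum>j\<in>UNIV. dx j (\<lambda>z. A * q * C z * dx j \<Psi> z) z)"
begin

definition lnC :: "spacetime \<Rightarrow> real" where "lnC z = ln (C z)"

text \<open>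
  The electrochemical potential: diffusion and drift together form the single flux \<open>A * C * grad \<phi>\<close>,
  so that \<open>\<phi>\<close> is the natural test function.
\<close>

definition \<phi> :: "spacetime \<Rightarrow> real" where "\<phi> z = lnC z + q * \<Psi> z"

lemma lnC_sm [simp, intro]: "sm lnC" and lnC_per [simp, intro]: "per L lnC"
  unfolding lnC_def[abs_def] using C_pos by auto

lemma \<phi>_sm [simp, intro]: "sm \<phi>" and \<phi>_per [simp, intro]: "per L \<phi>"
  unfolding \<phi>_def[abs_def] by auto

lemma pd_C: "pd v C = (\<lambda>z. C z * pd v lnC z)"
proof
  fix z show "pd v C z = C z * pd v lnC z"
    using C_pos[of z] unfolding lnC_def[abs_def]
    by (cases "z \<in> S") (simp_all add: pd_ln[OF C_pos C_sm] pd_outside)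
qed

lemma pd_\<phi>: "pd v \<phi> = (\<lambda>z. pd v lnC z + q * pd v \<Psi> z)"
  unfolding \<phi>_def[abs_def] by (simp add: pd_add pd_mult)

lemma transport_potential:
  assumes "z \<in> S"
  shows "dt C z = (\<Sum>j\<in>UNIV. dx j (\<lambda>z. C z * (A * dx j \<phi> z - U j z)) z)"
proof -
  have "dx j (\<lambda>z. C z * (A * dx j \<phi> z - U j z)) z = dx j (\<lambda>z. A * dx j C z) z
      + dx j (\<lambda>z. A * q * C z * dx j \<Psi> z) z - dx j (\<lambda>z. C z * U j z) z" for j
  proof -
    have "(\<lambda>z. C z * (A * dx j \<phi> z - U j z)) = (\<lambda>z. (A * dx j C z + A * q * C z * dx j \<Psi> z) - C z * U j z)"
      by (simp add: fun_eq_iff pd_\<phi> pd_C algebra_simps)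
    then show ?thesis by (simp add: pd_diff pd_add)
  qed
  with transport[OF assms] show ?thesis
    by (simp add: sum.distrib sum_subtractf)
qed

lemma potential_balance:
  "eq_mod_div L (\<lambda>z. \<phi> z * dt C z)
    (\<lambda>z. C z * (\<Sum>j\<in>UNIV. U j z * dx j \<phi> z) - A * C z * (\<Sum>j\<in>UNIV. (dx j \<phi> z)\<^sup>2))"
proof -
  have "eq_mod_div L (\<lambda>z. \<phi> z * (\<Sum>j\<in>UNIV. dx j (\<lambda>z. C z * (A * dx j \<phi> z - U j z)) z))
      (\<lambda>z. - (\<Sum>j\<in>UNIV. dx j \<phi> z * (C z * (A * dx j \<phi> z - U j z))))"
    by (rule eq_mod_div_by_parts) auto
  then show ?thesis
    by (rule eq_mod_div_cong) (simp_all add: transport_potential sum_3 algebra_simps power2_eq_square)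
qed

lemma dt_sigma: 
  "z \<in> S \<Longrightarrow> dt (\<lambda>z. sigma (C z)) z = lnC z * dt C z"
  unfolding sigma_def lnC_def[symmetric] by (simp add: pd_add pd_diff pd_mult pd_C algebra_simps)

lemma sigma_sm [simp, intro]: "sm (\<lambda>z. sigma (C z))"
  unfolding sigma_def lnC_def[symmetric] by auto

lemma relative_entropy_eq:
  assumes "z \<in> S"
  shows "R z * sigma (C z / R z) = C z * (lnC z - lnR z) - C z + R z"
  using C_pos[OF assms] R_pos[OF assms]
  by (simp add: sigma_def lnC_def lnR_def ln_div field_simps)

lemma relative_entropy_sm [simp, intro]: "sm (\<lambda>z. R z * sigma (C z / R z))"
  by (rule smooth_on_cong[of _ "\<lambda>z. C z * (lnC z - lnR z) - C z + R z"]) (auto simp: relative_entropy_eq)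

text \<open>
  The density \<open>C * (ln C - ln R) - C + R\<close> has the partial derivatives \<open>ln C - ln R\<close> in \<open>C\<close> and
  \<open>1 - C / R\<close> in \<open>R\<close>.  When the two conservation laws are tested with them, the convective terms cancel
  because \<open>R * grad (C / R) = C * grad (ln C - ln R)\<close>, and only the dissipative flux remains.
\<close>

lemma relative_entropy_balance:
  "eq_mod_div L (dt (\<lambda>z. R z * sigma (C z / R z)))
    (\<lambda>z. - (A * C z * (\<Sum>j\<in>UNIV. dx j \<phi> z * (dx j lnC z - dx j lnR z))))"
proof -
  let ?s = "\<lambda>z. lnC z - lnR z" and ?c = "\<lambda>z. C z / R z - 1"
  have d: "pd v ?c z * R z = C z * (pd v lnC z - pd v lnR z)" if "z \<in> S" for v z
    using R_pos[OF that] by (simp add: pd_diff pd_divide[OF R_pos] sm_divide[OF R_pos] pd_C pd_R field_simps)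
  have "eq_mod_div L
      (\<lambda>z. ?s z * (\<Sum>j\<in>UNIV. dx j (\<lambda>z. C z * (A * dx j \<phi> z - U j z)) z)
         + ?c z * (\<Sum>j\<in>UNIV. dx j (\<lambda>z. R z * U j z) z))
      (\<lambda>z. - (\<Sum>j\<in>UNIV. dx j ?s z * (C z * (A * dx j \<phi> z - U j z)))
         + - (\<Sum>j\<in>UNIV. dx j ?c z * (R z * U j z)))"
    by (intro eq_mod_div_add eq_mod_div_by_parts) (auto intro!: sm_diff sm_divide R_pos)
  then show ?thesis
  proof (rule eq_mod_div_cong)
    fix z assume z: "z \<in> S"
    have R: "(\<Sum>j\<in>UNIV. dx j (\<lambda>z. R z * U j z) z) = - dt R z" using mass[OF z] by simp
    have "dt (\<lambda>z. R z * sigma (C z / R z)) = dt (\<lambda>z. C z * ?s z - C z + R z)"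
      by (rule pd_cong) (simp add: relative_entropy_eq)
    then show "dt (\<lambda>z. R z * sigma (C z / R z)) z =
        ?s z * (\<Sum>j\<in>UNIV. dx j (\<lambda>z. C z * (A * dx j \<phi> z - U j z)) z)
         + ?c z * (\<Sum>j\<in>UNIV. dx j (\<lambda>z. R z * U j z) z)"
      unfolding R transport_potential[OF z, symmetric] using R_pos[OF z]
      by (simp add: pd_add pd_diff pd_mult pd_C pd_R field_simps)
    have "dx j ?c z * (R z * U j z) = C z * (dx j lnC z - dx j lnR z) * U j z" for j
      unfolding d[OF z, symmetric] by simp
    then have c: "(\<Sum>j\<in>UNIV. dx j ?c z * (R z * U j z)) = (\<Sum>j\<in>UNIV. C z * (dx j lnC z - dx j lnR z) * U j z)"
      by presburger
    show "- (A * C z * (\<Sum>j\<in>UNIV. dx j \<phi> z * (dx j lnC z - dx j lnR z))) =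
      - (\<Sum>j\<in>UNIV. dx j ?s z * (C z * (A * dx j \<phi> z - U j z))) + - (\<Sum>j\<in>UNIV. dx j ?c z * (R z * U j z))"
      unfolding c by (simp add: pd_diff sum_3 algebra_simps)
  qed
qed

end

section \<open>The local energy balance\<close>

text \<open>
  The pressure enters only through a smooth vector field \<open>Pg\<close>, which is its gradient along the flow.
  The local balances can then be computed with smooth functions only, although the pressure law may have a corner.
\<close>

locale flow = advected +
  fixes \<mu> e \<epsilon> Ap Am :: real and Cp Cm \<Psi> :: "spacetime \<Rightarrow> real" and Pg :: "3 \<Rightarrow> spacetime \<Rightarrow> real"
  assumes parameters_pos: "Ap > 0" "Am > 0"
    and cations: "species T L R U Ap e Cp \<Psi>" and anions: "species T L R U Am (- e) Cm \<Psi>"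
    and Pg_sm [simp, intro]: "sm (Pg i)"
    and momentum: "z \<in> S \<Longrightarrow> dt (\<lambda>z. R z * U i z) z + (\<Sum>j\<in>UNIV. dx j (\<lambda>z. R z * (U i z * U j z)) z) + Pg i z
        - 2 * \<mu> * (\<Sum>j\<in>UNIV. dx j (\<lambda>z. R z * (1/2 * (dx j (U i) z + dx i (U j) z))) z)
      = \<epsilon> * (\<Sum>j\<in>UNIV. dx j (dx j \<Psi>) z) * dx i \<Psi> z - (dx i Cp z + dx i Cm z)"
    and poisson: "z \<in> S \<Longrightarrow> - \<epsilon> * (\<Sum>j\<in>UNIV. dx j (dx j \<Psi>) z) = e * (Cp z - Cm z)"
begin

sublocale p: species T L R U Ap e Cp \<Psi> by (rule cations)
sublocale m: species T L R U Am "- e" Cm \<Psi> by (rule anions)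

text \<open>
  By the Poisson equation the electric force and the osmotic pressure combine to
  \<open>- (Cp * grad p.\<phi> + Cm * grad m.\<phi>)\<close>, the force whose work cancels against the convection of the ions.
\<close>

lemma velocity_transport:
  assumes z: "z \<in> S"
  shows "R z * (dt (U i) z + (\<Sum>j\<in>UNIV. U j z * dx j (U i) z))
    = - (Cp z * dx i p.\<phi> z + Cm z * dx i m.\<phi> z) - Pg i z
      + (\<Sum>j\<in>UNIV. dx j (\<lambda>z. \<mu> * R z * (dx j (U i) z + dx i (U j) z)) z)"
proof -
  have m: "dt R z = - (\<Sum>j\<in>UNIV. dx j R z * U j z + R z * dx j (U j) z)"
    using mass[OF z] by (simp add: pd_mult)
  have "\<epsilon> * (\<Sum>j\<in>UNIV. dx j (dx j \<Psi>) z) * dx i \<Psi> z - (dx i Cp z + dx i Cm z)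
      = - (e * (Cp z - Cm z)) * dx i \<Psi> z - (dx i Cp z + dx i Cm z)"
    unfolding poisson[OF z, symmetric] by simp
  also have "\<dots> = - (Cp z * dx i p.\<phi> z + Cm z * dx i m.\<phi> z)"
    by (simp add: p.pd_\<phi> m.pd_\<phi> p.pd_C m.pd_C algebra_simps)
  finally have F: "\<epsilon> * (\<Sum>j\<in>UNIV. dx j (dx j \<Psi>) z) * dx i \<Psi> z - (dx i Cp z + dx i Cm z)
      = - (Cp z * dx i p.\<phi> z + Cm z * dx i m.\<phi> z)" .
  have D: "2 * \<mu> * (\<Sum>j\<in>UNIV. dx j (\<lambda>z. R z * (1/2 * (dx j (U i) z + dx i (U j) z))) z)
      = (\<Sum>j\<in>UNIV. dx j (\<lambda>z. \<mu> * R z * (dx j (U i) z + dx i (U j) z)) z)"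
    by (simp add: pd_mult pd_add pd_divide_const sum_3) (simp add: field_simps)
  have "R z * (dt (U i) z + (\<Sum>j\<in>UNIV. U j z * dx j (U i) z))
      = dt (\<lambda>z. R z * U i z) z + (\<Sum>j\<in>UNIV. dx j (\<lambda>z. R z * (U i z * U j z)) z)"
    by (simp add: pd_mult m sum_3 algebra_simps)
  with momentum[OF z, of i] show ?thesis
    unfolding F D by simp
qed

text \<open>
  The effective velocity of Bresch and Desjardins.
\<close>

definition W :: "3 \<Rightarrow> spacetime \<Rightarrow> real" where "W i z = U i z + 2 * \<mu> * dx i lnR z"

lemma W_sm [simp, intro]: "sm (W i)" and W_per [simp, intro]: "per L (W i)"
  unfolding W_def[abs_def] by auto

text \<open>
  The viscous stress of \<open>U\<close> is symmetric.  Adding \<open>2 * \<mu>\<close> times the equation for the gradient of \<open>ln R\<close>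
  subtracts \<open>2 * \<mu> * R\<close> times the transposed gradient and leaves a skew stress.
\<close>

lemma W_transport:
  assumes z: "z \<in> S"
  shows "R z * (dt (W i) z + (\<Sum>j\<in>UNIV. U j z * dx j (W i) z))
    = - (Cp z * dx i p.\<phi> z + Cm z * dx i m.\<phi> z) - Pg i z
      + (\<Sum>j\<in>UNIV. dx j (\<lambda>z. \<mu> * R z * (dx j (U i) z - dx i (U j) z)) z)"
proof -
  have "R z * (dt (W i) z + (\<Sum>j\<in>UNIV. U j z * dx j (W i) z))
      = R z * (dt (U i) z + (\<Sum>j\<in>UNIV. U j z * dx j (U i) z))
        + 2 * \<mu> * (R z * (dt (dx i lnR) z + (\<Sum>j\<in>UNIV. U j z * dx j (dx i lnR) z)))"
    unfolding W_def[abs_def] by (simp add: pd_add pd_mult sum_3 algebra_simps)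
  then show ?thesis
    unfolding velocity_transport[OF z] grad_lnR_transport
    by (simp add: pd_add pd_diff pd_mult sum_3 algebra_simps)
qed

text \<open>
  A skew stress pairs only with the skew part of the gradient of \<open>W\<close>, and this equals the skew part of
  the gradient of \<open>U\<close> since \<open>W - U\<close> is a gradient field.
\<close>

lemma effective_velocity_balance:
  "eq_mod_div L (dt (\<lambda>z. 1/2 * (R z * (\<Sum>i\<in>UNIV. (W i z)\<^sup>2))))
    (\<lambda>z. - (\<Sum>i\<in>UNIV. W i z * (Cp z * dx i p.\<phi> z + Cm z * dx i m.\<phi> z + Pg i z))
      - \<mu> / 2 * R z * (\<Sum>i\<in>UNIV. \<Sum>j\<in>UNIV. (dx j (U i) z - dx i (U j) z)\<^sup>2))"
proof -
  have "eq_mod_div L (dt (\<lambda>z. 1/2 * (R z * (\<Sum>i\<in>UNIV. (W i z)\<^sup>2))))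
    (\<lambda>z. (\<Sum>i\<in>UNIV. W i z * (- (Cp z * dx i p.\<phi> z + Cm z * dx i m.\<phi> z) - Pg i z))
      - (\<Sum>i\<in>UNIV. \<Sum>j\<in>UNIV. dx j (W i) z * (\<mu> * R z * (dx j (U i) z - dx i (U j) z))))"
    by (rule kinetic_balance[where N = "\<lambda>i j z. \<mu> * R z * (dx j (U i) z - dx i (U j) z)"])
      (auto simp: W_transport)
  then show ?thesis
  proof (rule eq_mod_div_cong)
    fix z
    have sym: "dx j (dx i lnR) z = dx i (dx j lnR) z" for i j by (simp add: pd_commute)
    show "- (\<Sum>i\<in>UNIV. W i z * (Cp z * dx i p.\<phi> z + Cm z * dx i m.\<phi> z + Pg i z))
        - \<mu> / 2 * R z * (\<Sum>i\<in>UNIV. \<Sum>j\<in>UNIV. (dx j (U i) z - dx i (U j) z)\<^sup>2) =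
      (\<Sum>i\<in>UNIV. W i z * (- (Cp z * dx i p.\<phi> z + Cm z * dx i m.\<phi> z) - Pg i z))
      - (\<Sum>i\<in>UNIV. \<Sum>j\<in>UNIV. dx j (W i) z * (\<mu> * R z * (dx j (U i) z - dx i (U j) z)))"
      by (simp add: W_def[abs_def] pd_add pd_mult sum_3 sym[of 1 2] sym[of 1 3] sym[of 2 3] power2_eq_square field_simps)
  qed simp
qed

lemma electric_balance:
  "eq_mod_div L (dt (\<lambda>z. \<epsilon> / 2 * (\<Sum>i\<in>UNIV. (dx i \<Psi> z)\<^sup>2))) (\<lambda>z. e * \<Psi> z * (dt Cp z - dt Cm z))"
proof -
  have "eq_mod_div L (\<lambda>z. - \<epsilon> * (\<Psi> z * (\<Sum>j\<in>UNIV. dx j (dx j (dt \<Psi>)) z)))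
      (\<lambda>z. - \<epsilon> * (- (\<Sum>j\<in>UNIV. dx j \<Psi> z * dx j (dt \<Psi>) z)))"
    by (intro eq_mod_div_cmult eq_mod_div_by_parts) auto
  then have "eq_mod_div L (\<lambda>z. e * \<Psi> z * (dt Cp z - dt Cm z)) (dt (\<lambda>z. \<epsilon> / 2 * (\<Sum>i\<in>UNIV. (dx i \<Psi> z)\<^sup>2)))"
  proof (rule eq_mod_div_cong)
    fix z assume z: "z \<in> S"
    have tj: "dt (dx j f) = dx j (dt f)" if "sm f" for j f using that by (simp add: pd_commute)
    have "dt (\<lambda>z. - \<epsilon> * (\<Sum>j\<in>UNIV. dx j (dx j \<Psi>) z)) = dt (\<lambda>z. e * (Cp z - Cm z))"
      by (rule pd_cong) (rule poisson)
    then have "e * (dt Cp z - dt Cm z) = - \<epsilon> * (\<Sum>j\<in>UNIV. dx j (dx j (dt \<Psi>)) z)"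
      by (drule_tac fun_cong[of _ _ z]) (simp add: pd_mult pd_diff pd_sum pd_minus tj)
    from arg_cong[OF this, of "\<lambda>a. \<Psi> z * a"]
    show "e * \<Psi> z * (dt Cp z - dt Cm z) = - \<epsilon> * (\<Psi> z * (\<Sum>j\<in>UNIV. dx j (dx j (dt \<Psi>)) z))"
      by (simp add: algebra_simps)
    show "dt (\<lambda>z. \<epsilon> / 2 * (\<Sum>i\<in>UNIV. (dx i \<Psi> z)\<^sup>2)) z = - \<epsilon> * (- (\<Sum>j\<in>UNIV. dx j \<Psi> z * dx j (dt \<Psi>) z))"
      by (simp add: pd_mult pd_sum pd_power2 pd_add pd_divide_const tj sum_3) (simp add: field_simps)
  qed
  then show ?thesis by (rule eq_mod_div_sym)
qed

text \<open>
  Up to a divergence, the time derivatives of the electric energy and of the entropies are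
  \<open>e * \<Psi> * dt (Cp - Cm)\<close> and \<open>ln Cp * dt Cp + ln Cm * dt Cm\<close>; together they are the ion equations tested with their potentials.
\<close>

lemma free_energy_balance:
  "eq_mod_div L (\<lambda>z. dt (\<lambda>z. \<epsilon> / 2 * (\<Sum>i\<in>UNIV. (dx i \<Psi> z)\<^sup>2)) z + dt (\<lambda>z. sigma (Cp z) + sigma (Cm z)) z)
    (\<lambda>z. (\<Sum>i\<in>UNIV. U i z * (Cp z * dx i p.\<phi> z + Cm z * dx i m.\<phi> z))
      - Ap * Cp z * (\<Sum>i\<in>UNIV. (dx i p.\<phi> z)\<^sup>2) - Am * Cm z * (\<Sum>i\<in>UNIV. (dx i m.\<phi> z)\<^sup>2))"
proof -
  have s: "dt (\<lambda>z. sigma (Cp z) + sigma (Cm z)) z = p.lnC z * dt Cp z + m.lnC z * dt Cm z" if "z \<in> S" for z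
    using that by (simp add: pd_add p.dt_sigma m.dt_sigma)
  have "eq_mod_div L (\<lambda>z. dt (\<lambda>z. \<epsilon> / 2 * (\<Sum>i\<in>UNIV. (dx i \<Psi> z)\<^sup>2)) z + dt (\<lambda>z. sigma (Cp z) + sigma (Cm z)) z)
      (\<lambda>z. e * \<Psi> z * (dt Cp z - dt Cm z) + dt (\<lambda>z. sigma (Cp z) + sigma (Cm z)) z)"
    by (intro eq_mod_div_add electric_balance eq_mod_div_eq refl)
  also have "eq_mod_div L \<dots> (\<lambda>z. p.\<phi> z * dt Cp z + m.\<phi> z * dt Cm z)"
    by (rule eq_mod_div_eq) (simp only: s p.\<phi>_def m.\<phi>_def, simp add: algebra_simps)
  also have "eq_mod_div L \<dots> (\<lambda>z.
      (Cp z * (\<Sum>j\<in>UNIV. U j z * dx j p.\<phi> z) - Ap * Cp z * (\<Sum>j\<in>UNIV. (dx j p.\<phi> z)\<^sup>2))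
    + (Cm z * (\<Sum>j\<in>UNIV. U j z * dx j m.\<phi> z) - Am * Cm z * (\<Sum>j\<in>UNIV. (dx j m.\<phi> z)\<^sup>2)))"
    by (intro eq_mod_div_add p.potential_balance m.potential_balance)
  also have "eq_mod_div L \<dots> (\<lambda>z. (\<Sum>i\<in>UNIV. U i z * (Cp z * dx i p.\<phi> z + Cm z * dx i m.\<phi> z))
      - Ap * Cp z * (\<Sum>i\<in>UNIV. (dx i p.\<phi> z)\<^sup>2) - Am * Cm z * (\<Sum>i\<in>UNIV. (dx i m.\<phi> z)\<^sup>2))"
    by (rule eq_mod_div_eq) (simp add: sum_3 algebra_simps)
  finally show ?thesis .
qed

lemma charge_gradient_balance:
  "eq_mod_div L (\<lambda>z. - e * (\<Sum>j\<in>UNIV. dx j \<Psi> z * (dx j Cp z - dx j Cm z)))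
    (\<lambda>z. - \<epsilon> * (\<Sum>j\<in>UNIV. dx j (dx j \<Psi>) z)\<^sup>2)"
proof -
  have "eq_mod_div L (\<lambda>z. e * ((Cp z - Cm z) * (\<Sum>j\<in>UNIV. dx j (dx j \<Psi>) z)))
      (\<lambda>z. e * (- (\<Sum>j\<in>UNIV. dx j (\<lambda>z. Cp z - Cm z) z * dx j \<Psi> z)))"
    by (intro eq_mod_div_cmult eq_mod_div_by_parts) auto
  then have "eq_mod_div L (\<lambda>z. - \<epsilon> * (\<Sum>j\<in>UNIV. dx j (dx j \<Psi>) z)\<^sup>2)
      (\<lambda>z. - e * (\<Sum>j\<in>UNIV. dx j \<Psi> z * (dx j Cp z - dx j Cm z)))"
  proof (rule eq_mod_div_cong)
    fix z assume z: "z \<in> S"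
    have "- \<epsilon> * (\<Sum>j\<in>UNIV. dx j (dx j \<Psi>) z)\<^sup>2
        = (- \<epsilon> * (\<Sum>j\<in>UNIV. dx j (dx j \<Psi>) z)) * (\<Sum>j\<in>UNIV. dx j (dx j \<Psi>) z)"
      by (simp add: power2_eq_square)
    then show "- \<epsilon> * (\<Sum>j\<in>UNIV. dx j (dx j \<Psi>) z)\<^sup>2 = e * ((Cp z - Cm z) * (\<Sum>j\<in>UNIV. dx j (dx j \<Psi>) z))"
      unfolding poisson[OF z] by simp
  qed (simp add: pd_diff sum_3 algebra_simps)
  then show ?thesis by (rule eq_mod_div_sym)
qed

text \<open>
  The weights \<open>1 / Ap\<close> and \<open>1 / Am\<close> remove the mobilities from the two balances.  The first sum on the right,
  taken \<open>2 * \<mu>\<close> times, cancels the work that the ionic force does on \<open>W - U\<close> in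
  \<open>effective_velocity_balance\<close>: this is why the relative entropies belong in the energy.
\<close>

lemma relative_entropies_balance:
  "eq_mod_div L (dt (\<lambda>z. 1 / Ap * R z * sigma (Cp z / R z) + 1 / Am * R z * sigma (Cm z / R z)))
    (\<lambda>z. (\<Sum>i\<in>UNIV. dx i lnR z * (Cp z * dx i p.\<phi> z + Cm z * dx i m.\<phi> z))
      - Cp z * (\<Sum>i\<in>UNIV. (dx i p.lnC z)\<^sup>2) - Cm z * (\<Sum>i\<in>UNIV. (dx i m.lnC z)\<^sup>2)
      - \<epsilon> * (\<Sum>j\<in>UNIV. dx j (dx j \<Psi>) z)\<^sup>2)"
proof -
  have "eq_mod_div L (\<lambda>z. 1 / Ap * dt (\<lambda>z. R z * sigma (Cp z / R z)) z + 1 / Am * dt (\<lambda>z. R z * sigma (Cm z / R z)) z)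
      (\<lambda>z. 1 / Ap * (- (Ap * Cp z * (\<Sum>j\<in>UNIV. dx j p.\<phi> z * (dx j p.lnC z - dx j lnR z))))
        + 1 / Am * (- (Am * Cm z * (\<Sum>j\<in>UNIV. dx j m.\<phi> z * (dx j m.lnC z - dx j lnR z)))))"
    by (intro eq_mod_div_lincomb p.relative_entropy_balance m.relative_entropy_balance)
  also have "eq_mod_div L \<dots> (\<lambda>z. ((\<Sum>i\<in>UNIV. dx i lnR z * (Cp z * dx i p.\<phi> z + Cm z * dx i m.\<phi> z))
      - Cp z * (\<Sum>i\<in>UNIV. (dx i p.lnC z)\<^sup>2) - Cm z * (\<Sum>i\<in>UNIV. (dx i m.lnC z)\<^sup>2))
      + - e * (\<Sum>j\<in>UNIV. dx j \<Psi> z * (dx j Cp z - dx j Cm z)))"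
    using parameters_pos
    by (intro eq_mod_div_eq) (simp add: p.pd_\<phi> m.pd_\<phi> p.pd_C m.pd_C sum_3 algebra_simps power2_eq_square)
  also have "eq_mod_div L \<dots> (\<lambda>z. ((\<Sum>i\<in>UNIV. dx i lnR z * (Cp z * dx i p.\<phi> z + Cm z * dx i m.\<phi> z))
      - Cp z * (\<Sum>i\<in>UNIV. (dx i p.lnC z)\<^sup>2) - Cm z * (\<Sum>i\<in>UNIV. (dx i m.lnC z)\<^sup>2))
      + - \<epsilon> * (\<Sum>j\<in>UNIV. dx j (dx j \<Psi>) z)\<^sup>2)"
    by (intro eq_mod_div_add charge_gradient_balance eq_mod_div_eq refl)
  finally show ?thesis
    by (rule eq_mod_div_cong) (simp_all only: mult.assoc pd_lincomb[OF p.relative_entropy_sm m.relative_entropy_sm] diff_conv_add_uminus mult_minus_left)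
qed

lemma energy_balance:
  "eq_mod_div L
    (\<lambda>z. dt (\<lambda>z. 1/2 * (R z * (\<Sum>i\<in>UNIV. (W i z)\<^sup>2))) z
      + (dt (\<lambda>z. \<epsilon> / 2 * (\<Sum>i\<in>UNIV. (dx i \<Psi> z)\<^sup>2)) z + dt (\<lambda>z. sigma (Cp z) + sigma (Cm z)) z)
      + 2 * \<mu> * dt (\<lambda>z. 1 / Ap * R z * sigma (Cp z / R z) + 1 / Am * R z * sigma (Cm z / R z)) z)
    (\<lambda>z. - (\<Sum>i\<in>UNIV. U i z * Pg i z) - 2 * \<mu> * (\<Sum>i\<in>UNIV. dx i lnR z * Pg i z)
      - \<mu> / 2 * R z * (\<Sum>i\<in>UNIV. \<Sum>j\<in>UNIV. (dx j (U i) z - dx i (U j) z)\<^sup>2)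
      - Ap * Cp z * (\<Sum>i\<in>UNIV. (dx i p.\<phi> z)\<^sup>2) - Am * Cm z * (\<Sum>i\<in>UNIV. (dx i m.\<phi> z)\<^sup>2)
      - 2 * \<mu> * (Cp z * (\<Sum>i\<in>UNIV. (dx i p.lnC z)\<^sup>2)) - 2 * \<mu> * (Cm z * (\<Sum>i\<in>UNIV. (dx i m.lnC z)\<^sup>2))
      - 2 * \<mu> * (\<epsilon> * (\<Sum>j\<in>UNIV. dx j (dx j \<Psi>) z)\<^sup>2))"
  by (rule eq_mod_div_cong[OF eq_mod_div_add[OF eq_mod_div_add[OF effective_velocity_balance free_energy_balance]
        eq_mod_div_cmult[OF relative_entropies_balance, of "2 * \<mu>"]]])
    (simp_all add: W_def sum_3 algebra_simps)

end

section \<open>A pressure law with a corner and its internal energy\<close>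

lemma DERIV_unique_one_sided:
  fixes f g :: "real \<Rightarrow> real"
  assumes f: "(f has_real_derivative a) (at s)" and g: "(g has_real_derivative b) (at s)"
    and F: "F \<le> at s" "F \<noteq> bot" and eq: "\<forall>\<^sub>F x in F. f x = g x" "f s = g s"
  shows "a = b"
proof (rule tendsto_unique[OF F(2)])
  show "((\<lambda>x. (f x - f s) / (x - s)) \<longlongrightarrow> a) F"
    using f F(1) by (auto simp: has_field_derivative_iff intro: tendsto_mono)
  have "((\<lambda>x. (g x - g s) / (x - s)) \<longlongrightarrow> b) F"
    using g F(1) by (auto simp: has_field_derivative_iff intro: tendsto_mono)
  then show "((\<lambda>x. (f x - f s) / (x - s)) \<longlongrightarrow> b) F"
    by (rule Lim_transform_eventually) (use eq in \<open>auto elim: eventually_mono\<close>)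
qed

lemma DERIV_corner:
  fixes q1 q2 :: "real \<Rightarrow> real"
  assumes q1: "(q1 has_real_derivative a) (at r)" and q2: "(q2 has_real_derivative a) (at r)"
    and eq: "q1 r = q2 r"
  shows "((\<lambda>x. if x \<le> r then q1 x else q2 x) has_real_derivative a) (at r)"
  unfolding has_field_derivative_iff
proof (rule filterlim_split_at)
  let ?p = "\<lambda>x. if x \<le> r then q1 x else q2 x"
  have "((\<lambda>x. (q1 x - q1 r) / (x - r)) \<longlongrightarrow> a) (at_left r)"
    using q1 filterlim_at_split unfolding has_field_derivative_iff by blast
  then show "((\<lambda>x. (?p x - ?p r) / (x - r)) \<longlongrightarrow> a) (at_left r)"
    by (rule Lim_transform_eventually) (auto simp: eventually_at_filter)
  have "((\<lambda>x. (q2 x - q2 r) / (x - r)) \<longlongrightarrow> a) (at_right r)"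
    using q2 filterlim_at_split unfolding has_field_derivative_iff by blast
  then show "((\<lambda>x. (?p x - ?p r) / (x - r)) \<longlongrightarrow> a) (at_right r)"
    by (rule Lim_transform_eventually) (auto simp: eventually_at_filter eq)
qed

text \<open>
  Where the inner function crosses the corner with nonzero speed, it passes from one branch to the other.
  Differentiability of the composition then forces both one-sided slopes to agree.
\<close>

lemma corner_slopes:
  fixes q1 q2 g :: "real \<Rightarrow> real"
  assumes q1: "(q1 has_real_derivative a1) (at (g s))" and q2: "(q2 has_real_derivative a2) (at (g s))"
    and eq: "q1 (g s) = q2 (g s)"
    and g: "(g has_real_derivative g') (at s)" "g' > 0"
    and p: "((\<lambda>x. if g x \<le> g s then q1 (g x) else q2 (g x)) has_real_derivative b) (at s)"
  shows "a1 * g' = b" "a2 * g' = b"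
proof -
  let ?p = "\<lambda>x. if g x \<le> g s then q1 (g x) else q2 (g x)"
  have "\<forall>\<^sub>F x in at_left s. q1 (g x) = ?p x"
  proof -
    obtain d where "d > 0" and d: "\<forall>h>0. h < d \<longrightarrow> g (s - h) < g s"
      using DERIV_pos_inc_left[OF g] by blast
    have "g x < g s" if "s - d < x" "x < s" for x
      using d[rule_format, of "s - x"] that by simp
    then show ?thesis
      unfolding eventually_at_left_field using \<open>d > 0\<close> by (intro exI[of _ "s - d"]) force
  qed
  then show "a1 * g' = b"
    by (intro DERIV_unique_one_sided[OF DERIV_chain2[OF q1 g(1)] p, of "at_left s"]) (auto simp: at_le)
  have "\<forall>\<^sub>F x in at_right s. q2 (g x) = ?p x"
  proof -
    obtain d where "d > 0" and d: "\<forall>h>0. h < d \<longrightarrow> g s < g (s + h)"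
      using DERIV_pos_inc_right[OF g] by blast
    have "g s < g x" if "s < x" "x < s + d" for x
      using d[rule_format, of "x - s"] that by simp
    then show ?thesis
      unfolding eventually_at_right_field using \<open>d > 0\<close> by (intro exI[of _ "s + d"]) force
  qed
  then show "a2 * g' = b"
    by (intro DERIV_unique_one_sided[OF DERIV_chain2[OF q2 g(1)] p, of "at_right s"]) (auto simp: at_le eq)
qed

text \<open>
  The crossing may be in either direction; a decreasing inner function is reflected.
\<close>

lemma corner_chain_rule:
  fixes q1 q2 g :: "real \<Rightarrow> real"
  assumes q1: "(q1 has_real_derivative a1) (at (g s))" and q2: "(q2 has_real_derivative a2) (at (g s))"
    and eq: "q1 (g s) = q2 (g s)"
    and g: "(g has_real_derivative g') (at s)" "g' \<noteq> 0"
    and p: "((\<lambda>x. if g x \<le> g s then q1 (g x) else q2 (g x)) has_real_derivative b) (at s)"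
  shows "b = deriv (\<lambda>r. if r \<le> g s then q1 r else q2 r) (g s) * g'"
proof -
  have slopes: "a1 * g' = b \<and> a2 * g' = b"
  proof (cases "g' > 0")
    case True
    then show ?thesis using corner_slopes[OF q1 q2 eq g(1) True p] by simp
  next
    case False
    have m: "((\<lambda>x. f (- x)) has_real_derivative - c) (at (- s))" if "(f has_real_derivative c) (at s)" for f c
      using DERIV_mirror[of f c "- s"] that by simp
    show ?thesis
      using corner_slopes[of q1 a1 "\<lambda>x. g (- x)" "- s" q2 a2 "- g'" "- b"] q1 q2 eq m[OF g(1)] m[OF p] False g(2)
      by simp
  qed
  then have "a1 = a2" using g(2) by (metis mult_cancel_right)
  then have "deriv (\<lambda>r. if r \<le> g s then q1 r else q2 r) (g s) = a1"
    using DERIV_corner[of q1 a1 "g s" q2, OF q1 _ eq] q2 DERIV_imp_deriv by blast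
  with slopes show ?thesis by simp
qed

lemma DERIV_pressure_branches:
  assumes "r > 0"
  shows "((\<lambda>r. c1 * (1 - r powr (- 4 * k))) has_real_derivative c1 * (4 * k * r powr (- 4 * k - 1))) (at r)"
    and "((\<lambda>r. c2 * (r powr \<gamma> - 1)) has_real_derivative c2 * (\<gamma> * r powr (\<gamma> - 1))) (at r)"
  using assms by (auto intro!: derivative_eq_intros simp: powr_diff)

lemma pressure_eq: "pressure c1 c2 k \<gamma> =
   (\<lambda>r. if r \<le> 1 then c1 * (1 - r powr (- 4 * k)) else c2 * (r powr \<gamma> - 1))"
  by (simp add: pressure_def fun_eq_iff)

text \<open>
  The factor \<open>g'\<close> on both sides makes the chain rule true at density \<open>1\<close> as well: either \<open>g' = 0\<close> and both
  sides vanish, or the corner is crossed and the pressure is differentiable there by the preceding lemmas.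
\<close>

lemma pressure_chain_rule:
  assumes g: "(g has_real_derivative g') (at s)" "g s > 0"
    and p: "((\<lambda>x. pressure c1 c2 k \<gamma> (g x)) has_real_derivative b) (at s)"
  shows "b * g' = deriv (pressure c1 c2 k \<gamma>) (g s) * g'\<^sup>2"
proof -
  let ?p = "pressure c1 c2 k \<gamma>"
  have smooth: ?thesis if "(?p has_real_derivative a) (at (g s))" for a
  proof -
    have "b = a * g'" using DERIV_chain2[OF that g(1)] p DERIV_unique by blast
    then show ?thesis using DERIV_imp_deriv[OF that] by (simp add: power2_eq_square)
  qed
  consider "g' = 0" | "g s < 1" | "g s > 1" | "g' \<noteq> 0" "g s = 1" by linarith
  then show ?thesis
  proof cases
    case 2
    then have "\<forall>\<^sub>F r in nhds (g s). ?p r = c1 * (1 - r powr (- 4 * k))"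
      using eventually_nhds_in_open[of "{..<1}" "g s"] by (auto simp: pressure_eq elim: eventually_mono)
    from smooth[OF iffD2[OF DERIV_cong_ev[OF refl this refl] DERIV_pressure_branches(1)[OF g(2), of c1 k]]]
    show ?thesis .
  next
    case 3
    then have "\<forall>\<^sub>F r in nhds (g s). ?p r = c2 * (r powr \<gamma> - 1)"
      using eventually_nhds_in_open[of "{1<..}" "g s"] by (auto simp: pressure_eq elim: eventually_mono)
    from smooth[OF iffD2[OF DERIV_cong_ev[OF refl this refl] DERIV_pressure_branches(2)[OF g(2), of c2 \<gamma>]]]
    show ?thesis .
  next
    case 4
    have "b = deriv ?p (g s) * g'"
      using corner_chain_rule[OF DERIV_pressure_branches(1)[OF g(2), of c1 k] DERIV_pressure_branches(2)[OF g(2), of c2 \<gamma>] _ g(1), of b] p 4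
      by (simp add: pressure_eq)
    then show ?thesis by (simp add: power2_eq_square)
  qed simp
qed

lemma continuous_on_pressure: "continuous_on {0<..} (pressure c1 c2 k \<gamma>)"
  unfolding pressure_eq
  by (rule continuous_on_cases_le[where h = "\<lambda>r. r"]) (auto intro!: continuous_intros)

lemma DERIV_internal_energy:
  assumes "r > 0"
  shows "(internal_energy c1 c2 k \<gamma> has_real_derivative pressure c1 c2 k \<gamma> r / r\<^sup>2) (at r)"
proof -
  \<comment> \<open>An interval of positive numbers that contains the reference density \<open>1\<close> and has \<open>r\<close> in its interior.\<close>
  define a b where "a = min 1 r / 2" and "b = max 1 r + 1"
  have ab: "0 < a" "a < r" "r < b" "a \<le> 1" "1 \<le> b" using assms by (auto simp: a_def b_def)
  have "continuous_on {a..b} (\<lambda>s. pressure c1 c2 k \<gamma> s / s\<^sup>2)"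
    using ab by (intro continuous_intros continuous_on_subset[OF continuous_on_pressure]) auto
  then have "((\<lambda>u. LBINT s=ereal 1..ereal u. pressure c1 c2 k \<gamma> s / s\<^sup>2) has_vector_derivative
      pressure c1 c2 k \<gamma> r / r\<^sup>2) (at r within {a..b})"
    using ab by (intro interval_integral_FTC2) auto
  then show ?thesis
    using ab by (simp add: internal_energy_def[abs_def] has_real_derivative_iff_has_vector_derivative
        at_within_Icc_at one_ereal_def)
qed

section \<open>The integrated energy balance\<close>

context advected
begin

text \<open>
  The function \<open>w = h (R) + p (R) / R\<close> is the derivative of \<open>r * h r\<close> at \<open>R\<close>, and its gradient is
  \<open>grad (p (R)) / R\<close>: the terms with \<open>p (R)\<close> itself cancel.  The flux \<open>w * R * U\<close> is in
  general not smooth but only continuously differentiable in space, so its divergence is integrated directly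
  instead of being absorbed into \<open>eq_mod_div\<close>.
\<close>

lemma internal_energy_balance:
  fixes p h :: "real \<Rightarrow> real"
  assumes h: "\<And>r. r > 0 \<Longrightarrow> (h has_real_derivative p r / r\<^sup>2) (at r)"
    and p: "continuous_on {0<..} p"
    and Pg: "\<And>i. sm (Pg i)"
    and grad_p: "\<And>t x i s. t \<in> {0..<T} \<Longrightarrow>
      ((\<lambda>s. p (R (t, x + axis i s))) has_real_derivative Pg i (t, x + axis i s)) (at s)"
    and L: "\<And>i. L $ i > 0" and t: "t \<in> {0..<T}"
  shows "((\<lambda>t. integral (cbox 0 L) (\<lambda>x. R (t, x) * h (R (t, x)))) has_real_derivative
    integral (cbox 0 L) (\<lambda>x. \<Sum>i\<in>UNIV. U i (t, x) * Pg i (t, x))) (at t within {0..<T})"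
proof -
  have pos: "R (t, x) > 0" if "t \<in> {0..<T}" for t x using R_pos that by (simp add: mem_S)
  have h_cont: "continuous_on {0<..} h"
    using h by (intro continuous_at_imp_continuous_on) (auto intro: DERIV_isCont)
  have R_cont: "continuous_on S R" by (rule smooth_on_imp_continuous_on) simp
  \<comment> \<open>The specific enthalpy.\<close>
  define w where "w z = h (R z) + p (R z) / R z" for z
  have w_cont: "continuous_on S w"
    unfolding w_def[abs_def]
    by (intro continuous_intros R_cont continuous_on_compose2[OF h_cont R_cont] continuous_on_compose2[OF p R_cont])
      (use R_pos in force)+
  have w_slice: "continuous_on A (\<lambda>x. w (t, x))" for A
    by (rule continuous_on_compose2[OF w_cont]) (use t in \<open>auto intro!: continuous_intros simp: mem_S\<close>)
  have "((\<lambda>t. integral (cbox 0 L) (\<lambda>x. R (t, x) * h (R (t, x)))) has_real_derivative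
      integral (cbox 0 L) (\<lambda>x. w (t, x) * dt R (t, x))) (at t within {0..<T})"
  proof (rule leibniz_rule_field_derivative)
    show "((\<lambda>t. R (t, x) * h (R (t, x))) has_real_derivative w (t, x) * dt R (t, x)) (at t within {0..<T})"
      if "t \<in> {0..<T}" for t x
    proof -
      have "((\<lambda>r. r * h r) has_real_derivative w (t, x)) (at (R (t, x)))"
        using pos[OF that, of x] by (auto intro!: derivative_eq_intros h simp: w_def power2_eq_square)
      from DERIV_chain2[OF this sm_slice_time[OF R_sm that]] show ?thesis .
    qed
    show "(\<lambda>x. R (t, x) * h (R (t, x))) integrable_on cbox 0 L" if "t \<in> {0..<T}" for t
      using that pos by (intro integrable_continuous continuous_intros sm_continuous_slice R_sm
          continuous_on_compose2[OF h_cont]) auto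
    have "continuous_on S (\<lambda>z. w z * dt R z)"
      by (intro continuous_intros w_cont smooth_on_imp_continuous_on) simp
    then show "continuous_on ({0..<T} \<times> cbox 0 L) (\<lambda>(t, x). w (t, x) * dt R (t, x))"
      by (rule continuous_on_subset[of S, THEN continuous_on_eq]) (auto simp: S_def)
  qed (use t in auto)
  moreover have "integral (cbox 0 L) (\<lambda>x. w (t, x) * dt R (t, x))
      = integral (cbox 0 L) (\<lambda>x. \<Sum>i\<in>UNIV. U i (t, x) * Pg i (t, x))"
  proof -
    let ?F = "\<lambda>i x. w (t, x) * (R (t, x) * U i (t, x))"
    let ?F' = "\<lambda>i x. Pg i (t, x) * U i (t, x) + w (t, x) * dx i (\<lambda>z. R z * U i z) (t, x)"
    have F_cont: "continuous_on A (?F i)" "continuous_on A (?F' i)" for A i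
      using Pg by (intro continuous_intros w_slice sm_continuous_slice t; simp)+
    have zero: "integral (cbox 0 L) (?F' i) = 0" for i
    proof (rule integral_periodic_partial_zero[OF F_cont(1) _ L F_cont(2)])
      show "box_periodic L (?F i)"
        using R_per U_per[of i] t by (auto simp: box_periodic_def per_def w_def)
      fix x s
      have sl: "((\<lambda>s. f (t, x + axis i s)) has_real_derivative dx i f (t, x + axis i s)) (at s)" if "sm f" for f
        by (rule sm_slice_axis[OF that t])
      have "R (t, x + axis i s) > 0" by (rule pos[OF t])
      moreover have "((\<lambda>s. h (R (t, x + axis i s))) has_real_derivative
          p (R (t, x + axis i s)) / (R (t, x + axis i s))\<^sup>2 * dx i R (t, x + axis i s)) (at s)"
        by (rule DERIV_chain2[OF h[OF pos[OF t]] sl[OF R_sm]])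
      ultimately have "((\<lambda>s. w (t, x + axis i s)) has_real_derivative Pg i (t, x + axis i s) / R (t, x + axis i s)) (at s)"
        unfolding w_def
        by (auto intro!: derivative_eq_intros grad_p[OF t] sl simp: field_simps power2_eq_square)
      from DERIV_mult[OF this sl[of "\<lambda>z. R z * U i z"]]
      show "((\<lambda>s. ?F i (x + axis i s)) has_real_derivative ?F' i (x + axis i s)) (at s)"
        using \<open>R (t, x + axis i s) > 0\<close> by (simp add: mult.commute)
    qed
    have "integral (cbox 0 L) (\<lambda>x. w (t, x) * dt R (t, x))
        = integral (cbox 0 L) (\<lambda>x. (\<Sum>i\<in>UNIV. U i (t, x) * Pg i (t, x)) - (\<Sum>i\<in>UNIV. ?F' i x))"
      by (rule integral_cong) (simp add: dt_R sum.distrib sum_distrib_left mult.commute)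
    also have "\<dots> = integral (cbox 0 L) (\<lambda>x. \<Sum>i\<in>UNIV. U i (t, x) * Pg i (t, x))
        - integral (cbox 0 L) (\<lambda>x. \<Sum>i\<in>UNIV. ?F' i x)"
      using Pg t by (intro integral_diff integrable_continuous F_cont(2) continuous_on_sum
          continuous_on_mult sm_continuous_slice) auto
    also have "integral (cbox 0 L) (\<lambda>x. \<Sum>i\<in>UNIV. ?F' i x) = 0"
      using zero by (subst integral_sum) (auto intro!: integrable_continuous F_cont(2))
    finally show ?thesis by simp
  qed
  ultimately show ?thesis by simp
qed

end

context flow
begin

lemma integrated_energy_balance:
  assumes L: "\<And>i. L $ i > 0" and t: "t \<in> {0..<T}"
  defines "I \<equiv> \<lambda>f. integral (cbox 0 L) (\<lambda>x. f (t, x))"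
  shows "I (dt (\<lambda>z. 1/2 * (R z * (\<Sum>i\<in>UNIV. (W i z)\<^sup>2))))
      + (I (dt (\<lambda>z. \<epsilon> / 2 * (\<Sum>i\<in>UNIV. (dx i \<Psi> z)\<^sup>2))) + I (dt (\<lambda>z. sigma (Cp z) + sigma (Cm z))))
      + 2 * \<mu> * I (dt (\<lambda>z. 1 / Ap * R z * sigma (Cp z / R z) + 1 / Am * R z * sigma (Cm z / R z)))
    = - I (\<lambda>z. \<Sum>i\<in>UNIV. U i z * Pg i z) - 2 * \<mu> * I (\<lambda>z. \<Sum>i\<in>UNIV. dx i lnR z * Pg i z)
      - I (\<lambda>z. \<mu> / 2 * R z * (\<Sum>i\<in>UNIV. \<Sum>j\<in>UNIV. (dx j (U i) z - dx i (U j) z)\<^sup>2))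
      - I (\<lambda>z. Ap * Cp z * (\<Sum>i\<in>UNIV. (dx i p.\<phi> z)\<^sup>2)) - I (\<lambda>z. Am * Cm z * (\<Sum>i\<in>UNIV. (dx i m.\<phi> z)\<^sup>2))
      - 2 * \<mu> * I (\<lambda>z. Cp z * (\<Sum>i\<in>UNIV. (dx i p.lnC z)\<^sup>2)) - 2 * \<mu> * I (\<lambda>z. Cm z * (\<Sum>i\<in>UNIV. (dx i m.lnC z)\<^sup>2))
      - 2 * \<mu> * I (\<lambda>z. \<epsilon> * (\<Sum>j\<in>UNIV. dx j (dx j \<Psi>) z)\<^sup>2)"
proof -
  have add: "I (\<lambda>z. f z + g z) = I f + I g" and diff: "I (\<lambda>z. f z - g z) = I f - I g" if "sm f" "sm g" for f g
    using that t by (simp_all add: I_def integral_slice_add integral_slice_diff)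
  have rel: "sm (\<lambda>z. 1 / Ap * R z * sigma (Cp z / R z) + 1 / Am * R z * sigma (Cm z / R z))"
    unfolding mult.assoc by (intro sm_add sm_mult[OF sm_const] p.relative_entropy_sm m.relative_entropy_sm)
  have c: "I (\<lambda>z. c * f z) = c * I f" "I (\<lambda>z. - f z) = - I f" for c f
    by (simp_all add: I_def)
  have d: "sm (dt (\<lambda>z. 1/2 * (R z * (\<Sum>i\<in>UNIV. (W i z)\<^sup>2))))" "sm (dt (\<lambda>z. \<epsilon> / 2 * (\<Sum>i\<in>UNIV. (dx i \<Psi> z)\<^sup>2)))"
    "sm (dt (\<lambda>z. sigma (Cp z) + sigma (Cm z)))"
    by (intro sm_pd sm_mult sm_const sm_add sm_sum sm_power2 W_sm R_sm p.sigma_sm m.sigma_sm p.\<Psi>_sm)+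
  note s = sm_add sm_diff sm_minus sm_mult sm_sum sm_const sm_power2 sm_pd W_sm R_sm U_sm Pg_sm lnR_sm
    p.C_sm m.C_sm p.\<phi>_sm m.\<phi>_sm p.lnC_sm m.lnC_sm p.\<Psi>_sm
  have I_eq: "I f = I g" if "eq_mod_div L f g" "sm f" "sm g" for f g
    unfolding I_def by (rule eq_mod_div_integral[OF that L t])
  show ?thesis
    using I_eq[OF energy_balance] by (simp only: add diff c d rel s simp_thms)
qed

end

section \<open>Vector operators and the energy identity\<close>

lemma norm_vec_power2: "(norm (v :: real^3))\<^sup>2 = (\<Sum>i\<in>UNIV. (v $ i)\<^sup>2)"
  unfolding power2_norm_eq_inner by (simp add: inner_vec_def power2_eq_square)

lemma norm_matrix_power2: "(norm (A :: real^3^3))\<^sup>2 = (\<Sum>i\<in>UNIV. \<Sum>j\<in>UNIV. (A $ i $ j)\<^sup>2)"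
  unfolding power2_norm_eq_inner by (simp add: inner_vec_def power2_eq_square)

lemma grad_nth:
  assumes "(f has_derivative f') (at x)"
  shows "grad f x $ i = f' (axis i 1)"
  using frechet_derivative_at[OF assms] by (simp add: grad_def)

lemma DERIV_axis_line:
  assumes "f differentiable at (x + axis i s)"
  shows "((\<lambda>s. f (x + axis i s)) has_real_derivative grad f (x + axis i s) $ i) (at s)"
proof -
  define e where "e = axis i (1::real)"
  have e: "axis i s = s *\<^sub>R e" for s by (simp add: e_def axis_def vec_eq_iff)
  obtain f' where f': "(f has_derivative f') (at (x + s *\<^sub>R e))"
    using assms unfolding differentiable_def e by blast
  have "((\<lambda>s. x + s *\<^sub>R e) has_derivative (\<lambda>h. h *\<^sub>R e)) (at s)"
    by (auto intro!: derivative_eq_intros)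
  from has_derivative_compose[OF this f'] have "((\<lambda>s. f (x + s *\<^sub>R e)) has_derivative (\<lambda>h. h * f' e)) (at s)"
    using linear_scale[OF has_derivative_linear[OF f']] by simp
  then show ?thesis
    unfolding e grad_nth[OF f'] by (simp add: has_field_derivative_def mult_commute_abs)
qed

context slab
begin

lemma grad_slice:
  assumes "sm f" "t \<in> {0..<T}"
  shows "grad (\<lambda>y. f (t, y)) x $ i = dx i f (t, x)"
  by (rule grad_nth[OF sm_slice_space[OF assms]])

lemma jacobian_slice:
  assumes F: "\<And>i. sm (F i)" and t: "t \<in> {0..<T}"
  shows "jacobian (\<lambda>y. \<chi> i. F i (t, y)) (at x) $ i $ j = dx j (F i) (t, x)"
proof -
  have "((\<lambda>y. \<chi> i. F i (t, y)) has_derivative (\<lambda>h. \<chi> i. pd (0, h) (F i) (t, x))) (at x)"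
    unfolding has_derivative_componentwise_within[where f = "\<lambda>y. \<chi> i. F i (t, y)"]
    using sm_slice_space[OF F t] by (auto simp: Basis_vec_def inner_axis)
  then show ?thesis
    by (simp add: jacobian_def matrix_def frechet_derivative_at[symmetric])
qed

lemma divg_slice:
  assumes "\<And>i. sm (F i)" "t \<in> {0..<T}"
  shows "divg (\<lambda>y. \<chi> i. F i (t, y)) x = (\<Sum>i\<in>UNIV. dx i (F i) (t, x))"
  using jacobian_slice[of F t x, OF assms] by (simp add: divg_def trace_def)

lemma laplacian_slice:
  assumes "sm f" "t \<in> {0..<T}"
  shows "laplacian (\<lambda>y. f (t, y)) x = (\<Sum>i\<in>UNIV. dx i (dx i f) (t, x))"
proof -
  have "grad (\<lambda>y. f (t, y)) = (\<lambda>y. \<chi> i. dx i f (t, y))"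
    by (simp add: fun_eq_iff vec_eq_iff grad_slice[OF assms])
  then show ?thesis
    using divg_slice[OF sm_pd[OF assms(1)] assms(2)] by (simp add: laplacian_def[abs_def])
qed

lemma nontrivial_time: "t \<in> {0..<T} \<Longrightarrow> at t within {0..<T} \<noteq> bot"
  using T_pos by (simp add: trivial_limit_within islimpt_Ico)

lemma ddt_slice:
  assumes "sm f" "t \<in> {0..<T}"
  shows "ddt T (\<lambda>s y. f (s, y)) t x = dt f (t, x)"
  unfolding ddt_def using sm_slice_time[OF assms] assms(2)
  by (intro vector_derivative_within nontrivial_time)
    (simp_all add: has_real_derivative_iff_has_vector_derivative)

lemma ddt_vec_slice:
  assumes F: "\<And>i. sm (F i)" and t: "t \<in> {0..<T}"
  shows "ddt T (\<lambda>s y. \<chi> i. F i (s, y)) t x = (\<chi> i. dt (F i) (t, x))"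
proof -
  have "((\<lambda>s. \<chi> i. F i (s, x)) has_derivative (\<lambda>h. h *\<^sub>R (\<chi> i. dt (F i) (t, x)))) (at t within {0..<T})"
    unfolding has_derivative_componentwise_within[where f = "\<lambda>s. \<chi> i. F i (s, x)"]
    using sm_slice_time[OF F t] by (auto simp: Basis_vec_def inner_axis has_field_derivative_def mult_commute_abs)
  then show ?thesis
    unfolding ddt_def using t
    by (intro vector_derivative_within nontrivial_time) (simp_all add: has_vector_derivative_def)
qed

end

lemma (in advected) norm_skew_grad:
  assumes t: "t \<in> {0..<T}"
  shows "(norm (skew_grad (\<lambda>y. \<chi> i. U i (t, y)) x))\<^sup>2
    = 1/4 * (\<Sum>i\<in>UNIV. \<Sum>j\<in>UNIV. (dx j (U i) (t, x) - dx i (U j) (t, x))\<^sup>2)"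
  unfolding norm_matrix_power2
  by (simp add: skew_grad_def transpose_def jacobian_slice[OF U_sm t] power_mult_distrib sum_distrib_left power_divide)

context species
begin

lemma norm_grad_sqrt:
  assumes t: "t \<in> {0..<T}"
  shows "(norm (grad (\<lambda>y. sqrt (C (t, y))) x))\<^sup>2 = 1/4 * (C (t, x) * (\<Sum>i\<in>UNIV. (dx i lnC (t, x))\<^sup>2))"
proof -
  have pos: "C (t, x) > 0" using C_pos t by (simp add: mem_S)
  have "((\<lambda>y. sqrt (C (t, y))) has_derivative (\<lambda>h. pd (0, h) C (t, x) * (inverse (sqrt (C (t, x))) / 2))) (at x)"
    using has_derivative_compose[OF sm_slice_space[OF C_sm t]
        DERIV_real_sqrt[OF pos, unfolded has_field_derivative_def]] by (simp add: mult.commute)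
  from grad_nth[OF this] have "grad (\<lambda>y. sqrt (C (t, y))) x $ i
      = C (t, x) * inverse (sqrt (C (t, x))) * dx i lnC (t, x) / 2" for i
    by (simp add: pd_C)
  moreover have "C (t, x) * inverse (sqrt (C (t, x))) = sqrt (C (t, x))"
    using pos by (simp add: divide_inverse[symmetric] real_div_sqrt)
  ultimately have g: "grad (\<lambda>y. sqrt (C (t, y))) x $ i = sqrt (C (t, x)) * dx i lnC (t, x) / 2" for i
    by presburger
  then show ?thesis
    unfolding norm_vec_power2 g using pos by (simp add: power_mult_distrib power_divide sum_distrib_left)
qed

end

(* Since the pressure has a corner at density 1, the momentum equation is read classically:
   the gradient of p(\<rho>) has to exist.  Where \<rho> = 1 and p is not differentiable this forces
   grad \<rho> = 0, so the value of deriv p at the corner does not matter in the conclusion. *)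
theorem proposition6:
  fixes \<mu> e Ap Am \<epsilon> c1 c2 k \<gamma> T :: real
    and L :: "real^3"
    and u :: "real \<Rightarrow> real^3 \<Rightarrow> real^3"
    and \<rho> cp cm \<psi> :: "real \<Rightarrow> real^3 \<Rightarrow> real"
    and \<rho>0 cp0 cm0 :: "real^3 \<Rightarrow> real"
    and m0 :: "real^3 \<Rightarrow> real^3"
    and p h :: "real \<Rightarrow> real"
  defines "p \<equiv> pressure c1 c2 k \<gamma>"
    and "h \<equiv> internal_energy c1 c2 k \<gamma>"
  assumes "\<mu> > 0" "e > 0" "Ap > 0" "Am > 0" "\<epsilon> > 0"
    and "c1 > 0" "c2 > 0" "k \<ge> 1" "\<gamma> > 1"
    and "\<And>i. L $ i > 0"
    and "T > 0"
    and "smooth_periodic L T u" "smooth_periodic L T \<rho>"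
        "smooth_periodic L T cp" "smooth_periodic L T cm" "smooth_periodic L T \<psi>"
    and "\<And>t x. t \<in> {0..<T} \<Longrightarrow> \<rho> t x > 0 \<and> cp t x > 0 \<and> cm t x > 0"
    and mass: "\<And>t x. t \<in> {0..<T} \<Longrightarrow>
      ddt T \<rho> t x + divg (\<lambda>y. \<rho> t y *\<^sub>R u t y) x = 0"
    and momentum: "\<And>t x. t \<in> {0..<T} \<Longrightarrow>
      (\<lambda>y. p (\<rho> t y)) differentiable (at x) \<and>
      ddt T (\<lambda>s y. \<rho> s y *\<^sub>R u s y) t x
        + mat_divg (\<lambda>y. \<rho> t y *\<^sub>R outer (u t y) (u t y)) x
        + grad (\<lambda>y. p (\<rho> t y)) x
        - (2 * \<mu>) *\<^sub>R mat_divg (\<lambda>y. \<rho> t y *\<^sub>R sym_grad (u t) y) x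
      = (\<epsilon> * laplacian (\<psi> t) x) *\<^sub>R grad (\<psi> t) x - grad (\<lambda>y. cp t y + cm t y) x"
    and cations: "\<And>t x. t \<in> {0..<T} \<Longrightarrow>
      ddt T cp t x + divg (\<lambda>y. cp t y *\<^sub>R u t y) x
      = divg (\<lambda>y. Ap *\<^sub>R grad (cp t) y) x + divg (\<lambda>y. (Ap * e * cp t y) *\<^sub>R grad (\<psi> t) y) x"
    and anions: "\<And>t x. t \<in> {0..<T} \<Longrightarrow>
      ddt T cm t x + divg (\<lambda>y. cm t y *\<^sub>R u t y) x
      = divg (\<lambda>y. Am *\<^sub>R grad (cm t) y) x - divg (\<lambda>y. (Am * e * cm t y) *\<^sub>R grad (\<psi> t) y) x"
    and poisson: "\<And>t x. t \<in> {0..<T} \<Longrightarrow> - \<epsilon> * laplacian (\<psi> t) x = e * (cp t x - cm t x)"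
    and initial: "\<And>x. \<rho> 0 x = \<rho>0 x" "\<And>x. \<rho> 0 x *\<^sub>R u 0 x = m0 x"
        "\<And>x. cp 0 x = cp0 x" "\<And>x. cm 0 x = cm0 x"
  shows "\<forall>t\<in>{0..<T}. \<exists>dE.
    ((energy2 L h \<mu> \<epsilon> Ap Am u \<rho> cp cm \<psi>) has_real_derivative dE) (at t within {0..<T}) \<and>
    dE
    + 8 * \<mu> * integral (cbox 0 L) (\<lambda>x. (norm (grad (\<lambda>y. sqrt (cp t y)) x))\<^sup>2)
    + 8 * \<mu> * integral (cbox 0 L) (\<lambda>x. (norm (grad (\<lambda>y. sqrt (cm t y)) x))\<^sup>2)
    + 2 * \<mu> * integral (cbox 0 L) (\<lambda>x. \<epsilon> * (laplacian (\<psi> t) x)\<^sup>2)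
    + 2 * integral (cbox 0 L) (\<lambda>x. \<mu> * \<rho> t x * (norm (skew_grad (u t) x))\<^sup>2)
    + 2 * \<mu> * integral (cbox 0 L) (\<lambda>x. deriv p (\<rho> t x) / \<rho> t x * (norm (grad (\<rho> t) x))\<^sup>2)
    + integral (cbox 0 L)
        (\<lambda>x. Ap * cp t x * (norm (grad (\<lambda>y. ln (cp t y) + e * \<psi> t y) x))\<^sup>2)
    + integral (cbox 0 L)
        (\<lambda>x. Am * cm t x * (norm (grad (\<lambda>y. ln (cm t y) - e * \<psi> t y) x))\<^sup>2)
    = 0"
proof
  fix t assume t: "t \<in> {0..<T}"
  interpret slab T by unfold_locales fact
  define R where "R = (\<lambda>z. \<rho> (fst z) (snd z))"
  define U where "U = (\<lambda>i z. u (fst z) (snd z) $ i)"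
  define Cp where "Cp = (\<lambda>z. cp (fst z) (snd z))"
  define Cm where "Cm = (\<lambda>z. cm (fst z) (snd z))"
  define \<Psi> where "\<Psi> = (\<lambda>z. \<psi> (fst z) (snd z))"
  have sm0: "sm R" "sm Cp" "sm Cm" "sm \<Psi>"
    using assms(14-18) by (simp_all add: smooth_periodic_def S_def R_def Cp_def Cm_def \<Psi>_def case_prod_beta')
  have smU: "sm (U i)" for i
  proof -
    have "smooth_on S (\<lambda>z. u (fst z) (snd z))"
      using assms(14) by (simp add: smooth_periodic_def S_def case_prod_beta')
    from smooth_on_bounded_linear[OF bounded_linear_vec_nth this] show ?thesis by (simp add: U_def)
  qed
  have per0: "per L R" "per L Cp" "per L Cm" "per L \<Psi>" "per L (U i)" for i
    using assms(14-18)
    by (auto simp: smooth_periodic_def per_def box_periodic_def R_def Cp_def Cm_def \<Psi>_def U_def)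
  note sm0 [simp] smU [simp]
  have curry: "\<rho> s = (\<lambda>y. R (s, y))" "cp s = (\<lambda>y. Cp (s, y))" "cm s = (\<lambda>y. Cm (s, y))"
    "\<psi> s = (\<lambda>y. \<Psi> (s, y))" "u s = (\<lambda>y. \<chi> i. U i (s, y))" for s
    by (simp_all add: R_def Cp_def Cm_def \<Psi>_def U_def vec_eq_iff fun_eq_iff)
  have curry2: "\<rho> = (\<lambda>s y. R (s, y))" "cp = (\<lambda>s y. Cp (s, y))" "cm = (\<lambda>s y. Cm (s, y))"
    by (simp_all add: curry fun_eq_iff)
  have pos: "R z > 0" "Cp z > 0" "Cm z > 0" if "z \<in> S" for z
    using assms(19)[of "fst z" "snd z"] that by (cases z; simp add: R_def Cp_def Cm_def mem_S)+
  have grad_vec: "grad (\<lambda>y. f (s, y)) = (\<lambda>y. \<chi> i. dx i f (s, y))" if "sm f" "s \<in> {0..<T}" for f s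
    by (simp add: fun_eq_iff vec_eq_iff grad_slice[OF that])
  note laplacian_\<Psi> = laplacian_slice[OF sm0(4)]
  note grad_simps = sm0[THEN grad_vec]
  note ddt_simps = sm0[THEN ddt_slice]
  have scale: "a *\<^sub>R (\<chi> i. v i) = (\<chi> i. a * v i)" for a :: real and v :: "3 \<Rightarrow> real"
    by (simp add: vec_eq_iff)
  interpret advected T L R U
  proof unfold_locales
    fix z assume "z \<in> S"
    then show "dt R z + (\<Sum>j\<in>UNIV. dx j (\<lambda>z. R z * U j z) z) = 0"
      using mass[of "fst z" "snd z"]
      using divg_slice[of "\<lambda>j z. R z * U j z" "fst z" "snd z"]
      by (cases z) (simp add: mem_S curry2 curry(5) ddt_simps scale)
  qed (simp_all add: pos per0)
  interpret p: species T L R U Ap e Cp \<Psi>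
  proof unfold_locales
    fix z assume "z \<in> S"
    then show "dt Cp z + (\<Sum>j\<in>UNIV. dx j (\<lambda>z. Cp z * U j z) z)
      = (\<Sum>j\<in>UNIV. dx j (\<lambda>z. Ap * dx j Cp z) z) + (\<Sum>j\<in>UNIV. dx j (\<lambda>z. Ap * e * Cp z * dx j \<Psi> z) z)"
      using cations[of "fst z" "snd z"]
      divg_slice[of "\<lambda>j z. Cp z * U j z" "fst z" "snd z"]
        divg_slice[of "\<lambda>j z. Ap * dx j Cp z" "fst z" "snd z"]
        divg_slice[of "\<lambda>j z. Ap * e * Cp z * dx j \<Psi> z" "fst z" "snd z"]
      by (cases z) (simp add: mem_S curry2 curry(4,5) ddt_simps scale grad_simps)
  qed (simp_all add: pos per0)
  interpret m: species T L R U Am "- e" Cm \<Psi>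
  proof unfold_locales
    fix z assume "z \<in> S"
    then show "dt Cm z + (\<Sum>j\<in>UNIV. dx j (\<lambda>z. Cm z * U j z) z)
      = (\<Sum>j\<in>UNIV. dx j (\<lambda>z. Am * dx j Cm z) z) + (\<Sum>j\<in>UNIV. dx j (\<lambda>z. Am * - e * Cm z * dx j \<Psi> z) z)"
      using anions[of "fst z" "snd z"]
      divg_slice[of "\<lambda>j z. Cm z * U j z" "fst z" "snd z"]
        divg_slice[of "\<lambda>j z. Am * dx j Cm z" "fst z" "snd z"]
        divg_slice[of "\<lambda>j z. Am * e * Cm z * dx j \<Psi> z" "fst z" "snd z"]
      by (cases z) (simp add: mem_S curry2 curry(4,5) ddt_simps scale grad_simps pd_minus sum_negf)
  qed (simp_all add: pos per0)
  \<comment> \<open>The pressure gradient as the momentum equation expresses it, which shows that it is smooth.\<close>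
  define Pg where "Pg i z = \<epsilon> * (\<Sum>j\<in>UNIV. dx j (dx j \<Psi>) z) * dx i \<Psi> z - (dx i Cp z + dx i Cm z)
      - dt (\<lambda>z. R z * U i z) z - (\<Sum>j\<in>UNIV. dx j (\<lambda>z. R z * (U i z * U j z)) z)
      + 2 * \<mu> * (\<Sum>j\<in>UNIV. dx j (\<lambda>z. R z * (1/2 * (dx j (U i) z + dx i (U j) z))) z)" for i z
  have Pg_sm: "sm (Pg i)" for i
    unfolding Pg_def[abs_def]
    by (intro sm_add sm_diff sm_mult sm_sum sm_const sm_pd sm0 smU)
  note momentum_eq = momentum
  interpret flow T L R U \<mu> e \<epsilon> Ap Am Cp Cm \<Psi> Pg
  proof unfold_locales
    fix z assume "z \<in> S"
    then show "- \<epsilon> * (\<Sum>j\<in>UNIV. dx j (dx j \<Psi>) z) = e * (Cp z - Cm z)"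
      using poisson[of "fst z" "snd z"] by (cases z) (simp add: mem_S curry laplacian_\<Psi>)
  qed (use assms Pg_sm in \<open>simp_all add: Pg_def\<close>)
  have grad_p: "grad (\<lambda>y. p (R (s, y))) x $ i = Pg i (s, x)" and diff_p: "(\<lambda>y. p (R (s, y))) differentiable (at x)"
    if s: "s \<in> {0..<T}" for s x i
  proof -
    note m = momentum_eq[OF s, of x]
    show "(\<lambda>y. p (R (s, y))) differentiable (at x)" using m by (simp add: curry)
    have d1: "ddt T (\<lambda>s y. \<rho> s y *\<^sub>R u s y) s x $ i = dt (\<lambda>z. R z * U i z) (s, x)"
      using ddt_vec_slice[of "\<lambda>i z. R z * U i z", OF _ s] by (simp add: curry scale)
    have d2: "mat_divg (\<lambda>y. \<rho> s y *\<^sub>R outer (u s y) (u s y)) x $ i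
        = (\<Sum>j\<in>UNIV. dx j (\<lambda>z. R z * (U i z * U j z)) (s, x))"
      using divg_slice[of "\<lambda>j z. R z * (U i z * U j z)", OF _ s]
      by (simp add: curry mat_divg_def outer_def scale)
    have d3: "mat_divg (\<lambda>y. \<rho> s y *\<^sub>R sym_grad (u s) y) x $ i
        = (\<Sum>j\<in>UNIV. dx j (\<lambda>z. R z * (1/2 * (dx j (U i) z + dx i (U j) z))) (s, x))"
    proof -
      have "(\<rho> s y *\<^sub>R sym_grad (u s) y) $ i
          = (\<chi> j. R (s, y) * (1/2 * (dx j (U i) (s, y) + dx i (U j) (s, y))))" for y
        by (simp add: curry sym_grad_def transpose_def vec_eq_iff jacobian_slice[OF smU s])
      then show ?thesis
        unfolding mat_divg_def using divg_slice[of "\<lambda>j z. R z * (1/2 * (dx j (U i) z + dx i (U j) z))", OF _ s]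
        by simp
    qed
    have d4: "grad (\<lambda>y. cp s y + cm s y) x $ i = dx i Cp (s, x) + dx i Cm (s, x)"
      using grad_slice[of "\<lambda>z. Cp z + Cm z", OF _ s] by (simp add: curry pd_add)
    show "grad (\<lambda>y. p (R (s, y))) x $ i = Pg i (s, x)"
      using arg_cong[OF conjunct2[OF m], of "\<lambda>v. v $ i"] d1 d2 d3 d4 s
      by (simp add: Pg_def curry laplacian_\<Psi> grad_simps)
  qed
  have line_p: "((\<lambda>a. p (R (s, x + axis i a))) has_real_derivative Pg i (s, x + axis i a)) (at a)"
    if s: "s \<in> {0..<T}" for s x i a
    using DERIV_axis_line[OF diff_p[OF s]] by (simp add: grad_p[OF s])
  define I where "I f = (\<lambda>s. integral (cbox 0 L) (\<lambda>x. f (s, x)))" for f :: "spacetime \<Rightarrow> real"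
  define e1 where "e1 z = 1/2 * (R z * (\<Sum>i\<in>UNIV. (W i z)\<^sup>2))" for z
  define e3 where "e3 z = \<epsilon> / 2 * (\<Sum>i\<in>UNIV. (dx i \<Psi> z)\<^sup>2)" for z
  define e4 where "e4 z = sigma (Cp z) + sigma (Cm z)" for z
  define e5 where "e5 z = 1 / Ap * R z * sigma (Cp z / R z) + 1 / Am * R z * sigma (Cm z / R z)" for z
  have e_sm: "sm e1" "sm e3" "sm e4" "sm e5"
    unfolding e1_def[abs_def] e3_def[abs_def] e4_def[abs_def] e5_def[abs_def] mult.assoc
    by (intro sm_mult sm_const sm_add sm_sum sm_power2 sm_pd W_sm sm0 p.sigma_sm m.sigma_sm
        p.relative_entropy_sm m.relative_entropy_sm)+
  have energy: "energy2 L h \<mu> \<epsilon> Ap Am u \<rho> cp cm \<psi> s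
      = I e1 s + I (\<lambda>z. R z * h (R z)) s + I e3 s + I e4 s + 2 * \<mu> * I e5 s"
    if s: "s \<in> {0..<T}" for s
  proof -
    have "1/2 * integral (cbox 0 L) (\<lambda>x. \<rho> s x * (norm (u s x + (2 * \<mu>) *\<^sub>R grad (\<lambda>y. ln (\<rho> s y)) x))\<^sup>2) = I e1 s"
    proof -
      have "grad (\<lambda>y. ln (\<rho> s y)) x $ i = dx i lnR (s, x)" for x i
        using grad_slice[OF lnR_sm s] by (simp add: lnR_def curry)
      then show ?thesis
        unfolding I_def e1_def integral_mult_right[symmetric] norm_vec_power2
        by (simp add: curry W_def)
    qed
    moreover have "integral (cbox 0 L) (\<lambda>x. \<epsilon> * ((norm (grad (\<psi> s) x))\<^sup>2 / 2)) = I e3 s"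
      unfolding I_def e3_def norm_vec_power2 by (simp add: curry grad_simps[OF s])
    ultimately show ?thesis
      unfolding energy2_def by (simp add: I_def e4_def e5_def curry)
  qed
  define dE where "dE = I (dt e1) t + I (\<lambda>z. \<Sum>i\<in>UNIV. U i z * Pg i z) t + I (dt e3) t + I (dt e4) t + 2 * \<mu> * I (dt e5) t"
  have "((\<lambda>s. I e1 s + I (\<lambda>z. R z * h (R z)) s + I e3 s + I e4 s + 2 * \<mu> * I e5 s) has_real_derivative dE) (at t within {0..<T})"
    unfolding dE_def I_def
    by (intro DERIV_add DERIV_cmult integral_dt e_sm t
        internal_energy_balance[OF _ _ Pg_sm line_p])
      (use assms DERIV_internal_energy continuous_on_pressure in \<open>auto simp: p_def h_def\<close>)
  then have der: "(energy2 L h \<mu> \<epsilon> Ap Am u \<rho> cp cm \<psi> has_real_derivative dE) (at t within {0..<T})"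
    by (rule has_field_derivative_transform_within[where d = 1]) (use t energy in auto)
  have posx: "R (t, x) > 0" for x using pos t by (simp add: mem_S)
  have D1: "8 * \<mu> * integral (cbox 0 L) (\<lambda>x. (norm (grad (\<lambda>y. sqrt (cp t y)) x))\<^sup>2)
      = 2 * \<mu> * I (\<lambda>z. Cp z * (\<Sum>i\<in>UNIV. (dx i p.lnC z)\<^sup>2)) t"
    by (simp add: I_def curry p.norm_grad_sqrt[OF t])
  have D2: "8 * \<mu> * integral (cbox 0 L) (\<lambda>x. (norm (grad (\<lambda>y. sqrt (cm t y)) x))\<^sup>2)
      = 2 * \<mu> * I (\<lambda>z. Cm z * (\<Sum>i\<in>UNIV. (dx i m.lnC z)\<^sup>2)) t"
    by (simp add: I_def curry m.norm_grad_sqrt[OF t])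
  have D3: "integral (cbox 0 L) (\<lambda>x. \<epsilon> * (laplacian (\<psi> t) x)\<^sup>2) = I (\<lambda>z. \<epsilon> * (\<Sum>j\<in>UNIV. dx j (dx j \<Psi>) z)\<^sup>2) t"
    by (simp add: I_def curry laplacian_\<Psi>[OF t])
  have D4: "2 * integral (cbox 0 L) (\<lambda>x. \<mu> * \<rho> t x * (norm (skew_grad (u t) x))\<^sup>2)
      = I (\<lambda>z. \<mu> / 2 * R z * (\<Sum>i\<in>UNIV. \<Sum>j\<in>UNIV. (dx j (U i) z - dx i (U j) z)\<^sup>2)) t"
    unfolding I_def integral_mult_right[symmetric] by (simp add: curry norm_skew_grad[OF t] mult.assoc)
  have D5: "integral (cbox 0 L) (\<lambda>x. deriv p (\<rho> t x) / \<rho> t x * (norm (grad (\<rho> t) x))\<^sup>2)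
      = I (\<lambda>z. \<Sum>i\<in>UNIV. dx i lnR z * Pg i z) t"
  proof -
    have axis0: "axis i 0 = (0 :: real^3)" for i by (simp add: axis_def vec_eq_iff)
    \<comment> \<open>At each point the chain rule is used along the line in direction \<open>i\<close>, at parameter \<open>0\<close>.\<close>
    have "Pg i (t, x) * dx i R (t, x) = deriv p (R (t, x)) * (dx i R (t, x))\<^sup>2" for i x
      using pressure_chain_rule[OF sm_slice_axis[OF sm0(1) t, of x i 0] _ line_p[OF t, of x i 0, unfolded p_def]]
        posx by (simp add: p_def axis0)
    then have "deriv p (R (t, x)) / R (t, x) * (dx i R (t, x))\<^sup>2 = dx i lnR (t, x) * Pg i (t, x)" for i x
      using posx[of x] by (simp add: pd_R power_mult_distrib field_simps)
    then show ?thesis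
      by (simp add: I_def curry norm_vec_power2 grad_simps[OF t] sum_distrib_left)
  qed
  have D6: "integral (cbox 0 L) (\<lambda>x. Ap * cp t x * (norm (grad (\<lambda>y. ln (cp t y) + e * \<psi> t y) x))\<^sup>2)
      = I (\<lambda>z. Ap * Cp z * (\<Sum>i\<in>UNIV. (dx i p.\<phi> z)\<^sup>2)) t"
    using grad_slice[OF p.\<phi>_sm t] by (simp add: I_def curry norm_vec_power2 p.\<phi>_def p.lnC_def)
  have D7: "integral (cbox 0 L) (\<lambda>x. Am * cm t x * (norm (grad (\<lambda>y. ln (cm t y) - e * \<psi> t y) x))\<^sup>2)
      = I (\<lambda>z. Am * Cm z * (\<Sum>i\<in>UNIV. (dx i m.\<phi> z)\<^sup>2)) t"
    using grad_slice[OF m.\<phi>_sm t] by (simp add: I_def curry norm_vec_power2 m.\<phi>_def m.lnC_def)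
  from integrated_energy_balance[OF assms(12) t, folded e1_def e3_def e4_def e5_def I_def]
  show "\<exists>dE. ((energy2 L h \<mu> \<epsilon> Ap Am u \<rho> cp cm \<psi>) has_real_derivative dE) (at t within {0..<T}) \<and>
    dE
    + 8 * \<mu> * integral (cbox 0 L) (\<lambda>x. (norm (grad (\<lambda>y. sqrt (cp t y)) x))\<^sup>2)
    + 8 * \<mu> * integral (cbox 0 L) (\<lambda>x. (norm (grad (\<lambda>y. sqrt (cm t y)) x))\<^sup>2)
    + 2 * \<mu> * integral (cbox 0 L) (\<lambda>x. \<epsilon> * (laplacian (\<psi> t) x)\<^sup>2)
    + 2 * integral (cbox 0 L) (\<lambda>x. \<mu> * \<rho> t x * (norm (skew_grad (u t) x))\<^sup>2)
    + 2 * \<mu> * integral (cbox 0 L) (\<lambda>x. deriv p (\<rho> t x) / \<rho> t x * (norm (grad (\<rho> t) x))\<^sup>2)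
    + integral (cbox 0 L)
        (\<lambda>x. Ap * cp t x * (norm (grad (\<lambda>y. ln (cp t y) + e * \<psi> t y) x))\<^sup>2)
    + integral (cbox 0 L)
        (\<lambda>x. Am * cm t x * (norm (grad (\<lambda>y. ln (cm t y) - e * \<psi> t y) x))\<^sup>2)
    = 0"
    unfolding D1 D2 D3 D4 D5 D6 D7
    by (intro exI[of _ dE] conjI der) (simp add: dE_def I_def)
qed

end
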